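(* Let $(\mathbb{G},\circ)$ be a stratified Lie group of homogeneous dimension $Q$, let $\{X_1,\dots,X_{N_1}\}$ be left-invariant vector fields forming a basis of the first layer of its Lie algebra, let $\mathcal{L}=\sum_{j=1}^{N_1}X_j^2$, let $\Gamma$ be the heat kernel of $\mathcal{L}$, and let $B(x,r)$ denote Carnot-Carathéodory balls. Let $c_1\ge1$ be a constant, depending only on $\{X_1,\dots,X_{N_1}\}$, for which the Gaussian estimates $$c_1^{-1}t^{-\frac Q2}\exp\Big(-\frac{c_1\mathbf{d}(x)^2}{t}\Big)\le\Gamma(x,t)\le c_1t^{-\frac Q2}\exp\Big(-\frac{\mathbf{d}(x)^2}{c_1t}\Big)$$ hold for all $x\in\mathbb{G}$ and $t\in(0,\infty)$. Let $\mu$ be a Radon measure on $\mathbb{G}$ such that $\Gamma[\mu](x,t):=\int_{\mathbb{G}}\Gamma(\xi^{-1}\circ x,t)\,d\mu(\xi)<+\infty$ for all $(x,t)\in\mathbb{G}\times(0,\infty)$. Let $\alpha\in[0,Q)$. Then for any $x\in\mathbb{G}$, $$\limsup_{t\to0+}\,t^{\frac\alpha2}\,\Gamma[\mu](x,t)\le c(\alpha)\,\limsup_{r\to0}\frac{\mu(B(x,r))}{r^{Q-\alpha}},$$ with $$c(\alpha)=c_1^{\left(1+\frac{Q-\alpha}{2}\right)}(Q-\alpha)\int_0^\infty\exp(-r^2)\,r^{Q-\alpha-1}\,dr.$$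
   Context: A stratified Lie group (Carnot group) $(\mathbb{G},\circ)$ is a connected, simply connected nilpotent Lie group whose Lie algebra decomposes as a vector space $\mathfrak{g}=V_1\oplus\cdots\oplus V_l$ with $[V_1,V_j]=V_{j+1}$ for $1\le j<l$ and $[V_1,V_l]=0$, where $[V_1,V_j]=\mathrm{span}\{[X,Y]: X\in V_1,Y\in V_j\}$. The first layer is $V_1$. The homogeneous dimension is $Q=\sum_{j=1}^l j\dim V_j$. The identity of $\mathbb{G}$ is denoted $0$, and $m$ is the bi-invariant Haar measure on $\mathbb{G}$ obtained as the push-forward of Lebesgue measure on $\mathfrak{g}$ under $\exp$. The Carnot-Carathéodory metric $d$ associated with $\{X_1,\dots,X_{N_1}\}$ is the left-invariant metric on $\mathbb{G}$ defined by: $d(x,y)$ is the infimum of all $T>0$ for which there is an absolutely continuous curve $\gamma:[0,T]\to\mathbb{G}$ with $\gamma(0)=x$, $\gamma(T)=y$, $\gamma'(s)=\sum_j a_j(s)X_j(\gamma(s))$ and $\sum_j a_j(s)^2\le1$ for a.e. $s$ (and $d(x,x)=0$). Put $\mathbf{d}(x)=d(0,x)$ and $B(x,r)=\{y\in\mathbb{G}: d(x,y)<r\}$. The heat kernel $\Gamma:\mathbb{G}\times(0,\infty)\to(0,\infty)$ is the smooth, strictly positive function such that $(x,t;\xi)\mapsto\Gamma(\xi^{-1}\circ x,t)$ is the fundamental solution of $\partial_t-\mathcal{L}$, normalized by $\int_{\mathbb{G}}\Gamma(\xi^{-1}\circ x,t)\,dm(\xi)=1$. A constant $c_1$ as in the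 claim is known to exist. Radon measures are positive (non-negative) Borel measures, finite on compact sets. The right-hand limsup may be $+\infty$. *)

theory Defs
  imports "HOL-Analysis.Analysis" "HOL-Library.Function_Algebras"
begin

section \<open>Smooth functions on open sets of Euclidean spaces\<close>

fun Ck_on :: "nat \<Rightarrow> ('a::euclidean_space \<Rightarrow> 'b::real_normed_vector) \<Rightarrow> 'a set \<Rightarrow> bool" where
  "Ck_on 0 f S \<longleftrightarrow> continuous_on S f"
| "Ck_on (Suc k) f S \<longleftrightarrow>
     (\<forall>p\<in>S. f differentiable at p) \<and>
     (\<forall>b\<in>Basis. Ck_on k (\<lambda>p. frechet_derivative f (at p) b) S)"

text \<open>Meaningful for open \<^term>\<open>S\<close> only, which is how it is used below.\<close>

definition smooth_on :: "('a::euclidean_space \<Rightarrow> 'b::real_normed_vector) \<Rightarrow> 'a set \<Rightarrow> bool" where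
  "smooth_on f S \<longleftrightarrow> (\<forall>k. Ck_on k f S)"


section \<open>Lie groups\<close>

text \<open>
  The group is a type of class \<open>topological_group_add\<close>. That class is not commutative: the group
  law \<open>x \<circ> y\<close> is written \<open>x + y\<close>, the inverse of \<open>x\<close> is \<open>- x\<close> and the identity is \<open>0\<close>.
  The smooth structure is given by an atlas of charts \<open>(U, \<phi>)\<close> with values in a Euclidean space
  \<open>'e\<close>, so that the dimension is \<open>DIM('e)\<close>. The atlas need not be maximal.
\<close>

type_synonym ('g, 'e) atlas = "('g set \<times> ('g \<Rightarrow> 'e)) set"

definition smooth_atlas :: "('g::topological_space, 'e::euclidean_space) atlas \<Rightarrow> bool" where
  "smooth_atlas A \<longleftrightarrow>
     (\<forall>(U, \<phi>)\<in>A. open U \<and> open (\<phi> ` U) \<and> homeomorphism U (\<phi> ` U) \<phi> (inv_into U \<phi>)) \<and>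
     (\<Union>(U, \<phi>)\<in>A. U) = UNIV \<and>
     (\<forall>(U, \<phi>)\<in>A. \<forall>(V, \<psi>)\<in>A. smooth_on (\<lambda>p. \<psi> (inv_into U \<phi> p)) (\<phi> ` (U \<inter> V)))"

definition lie_group ::
  "('g::{topological_group_add, t2_space, second_countable_topology}, 'e::euclidean_space) atlas \<Rightarrow> bool" where
  "lie_group A \<longleftrightarrow>
     smooth_atlas A \<and>
     (\<forall>(U, \<phi>)\<in>A. \<forall>(V, \<psi>)\<in>A. \<forall>(W, \<omega>)\<in>A.
        smooth_on (\<lambda>(p, q). \<omega> (inv_into U \<phi> p + inv_into V \<psi> q))
          {(\<phi> x, \<psi> y) |x y. x \<in> U \<and> y \<in> V \<and> x + y \<in> W}) \<and>
     (\<forall>(U, \<phi>)\<in>A. \<forall>(V, \<psi>)\<in>A.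
        smooth_on (\<lambda>p. \<psi> (- inv_into U \<phi> p)) {\<phi> x |x. x \<in> U \<and> - x \<in> V})"

definition smooth_fun :: "('g::topological_space, 'e::euclidean_space) atlas \<Rightarrow> ('g \<Rightarrow> real) \<Rightarrow> bool" where
  "smooth_fun A f \<longleftrightarrow> (\<forall>(U, \<phi>)\<in>A. smooth_on (\<lambda>p. f (inv_into U \<phi> p)) (\<phi> ` U))"

text \<open>Smoothness on \<open>G \<times> I\<close> for an open set \<open>I\<close> of times.\<close>

definition smooth_fun_time ::
  "('g::topological_space, 'e::euclidean_space) atlas \<Rightarrow> real set \<Rightarrow> ('g \<Rightarrow> real \<Rightarrow> real) \<Rightarrow> bool" where
  "smooth_fun_time A I F \<longleftrightarrow>
     (\<forall>(U, \<phi>)\<in>A. smooth_on (\<lambda>(p, t). F (inv_into U \<phi> p) t) (\<phi> ` U \<times> I))"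


section \<open>The Lie algebra\<close>

instantiation "fun" :: (type, real_vector) real_vector
begin

definition scaleR_fun :: "real \<Rightarrow> ('a \<Rightarrow> 'b) \<Rightarrow> 'a \<Rightarrow> 'b" where
  "scaleR_fun c f = (\<lambda>x. c *\<^sub>R f x)"

instance
  by standard (simp_all add: scaleR_fun_def fun_eq_iff scaleR_add_right scaleR_add_left)

end

text \<open>
  Smooth vector fields are the derivations of the algebra of smooth functions. Since they are
  represented by total operators on \<open>'g \<Rightarrow> real\<close>, they are required to vanish at non-smooth
  functions, so that an operator is determined by its action on smooth functions.
\<close>

type_synonym 'g vfield = "('g \<Rightarrow> real) \<Rightarrow> 'g \<Rightarrow> real"

definition vector_field :: "('g::topological_space, 'e::euclidean_space) atlas \<Rightarrow> 'g vfield \<Rightarrow> bool" where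
  "vector_field A X \<longleftrightarrow>
     (\<forall>f. smooth_fun A f \<longrightarrow> smooth_fun A (X f)) \<and>
     (\<forall>f. \<not> smooth_fun A f \<longrightarrow> X f = 0) \<and>
     (\<forall>f g a b. smooth_fun A f \<longrightarrow> smooth_fun A g \<longrightarrow>
        X (\<lambda>x. a * f x + b * g x) = (\<lambda>x. a * X f x + b * X g x)) \<and>
     (\<forall>f g. smooth_fun A f \<longrightarrow> smooth_fun A g \<longrightarrow>
        X (\<lambda>x. f x * g x) = (\<lambda>x. X f x * g x + f x * X g x))"

definition left_invariant ::
  "('g::{topological_space, plus}, 'e::euclidean_space) atlas \<Rightarrow> 'g vfield \<Rightarrow> bool" where
  "left_invariant A X \<longleftrightarrow>
     (\<forall>f a. smooth_fun A f \<longrightarrow> X (\<lambda>x. f (a + x)) = (\<lambda>x. X f (a + x)))"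

definition lie_algebra ::
  "('g::{topological_space, plus}, 'e::euclidean_space) atlas \<Rightarrow> 'g vfield set" where
  "lie_algebra A = {X. vector_field A X \<and> left_invariant A X}"

definition lie_bracket :: "'g vfield \<Rightarrow> 'g vfield \<Rightarrow> 'g vfield" where
  "lie_bracket X Y = (\<lambda>f x. X (Y f) x - Y (X f) x)"

definition bracket_span :: "'g vfield set \<Rightarrow> 'g vfield set \<Rightarrow> 'g vfield set" where
  "bracket_span V W = span {lie_bracket X Y |X Y. X \<in> V \<and> Y \<in> W}"

fun lower_central :: "'g vfield set \<Rightarrow> nat \<Rightarrow> 'g vfield set" where
  "lower_central L 0 = L"
| "lower_central L (Suc k) = bracket_span L (lower_central L k)"

definition nilpotent_lie_algebra :: "'g vfield set \<Rightarrow> bool" where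
  "nilpotent_lie_algebra L \<longleftrightarrow> (\<exists>k. lower_central L k = {0})"


section \<open>Stratified Lie groups\<close>

definition stratification :: "'g vfield set \<Rightarrow> (nat \<Rightarrow> 'g vfield set) \<Rightarrow> nat \<Rightarrow> bool" where
  "stratification L V l \<longleftrightarrow>
     1 \<le> l \<and>
     (\<forall>j\<in>{1..l}. subspace (V j) \<and> V j \<subseteq> L) \<and>
     (\<forall>X\<in>L. \<exists>!Y. (\<forall>j\<in>{1..l}. Y j \<in> V j) \<and> (\<forall>j. j \<notin> {1..l} \<longrightarrow> Y j = 0) \<and>
                 X = (\<Sum>j=1..l. Y j)) \<and>
     (\<forall>j. 1 \<le> j \<and> j < l \<longrightarrow> bracket_span (V 1) (V j) = V (j + 1)) \<and>
     bracket_span (V 1) (V l) = {0}"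

text \<open>A connected Lie group is nilpotent iff its Lie algebra is.\<close>

definition stratified_lie_group ::
  "('g::{topological_group_add, t2_space, second_countable_topology}, 'e::euclidean_space) atlas
    \<Rightarrow> (nat \<Rightarrow> 'g vfield set) \<Rightarrow> nat \<Rightarrow> bool" where
  "stratified_lie_group A V l \<longleftrightarrow>
     lie_group A \<and> connected (UNIV :: 'g set) \<and> simply_connected (UNIV :: 'g set) \<and>
     nilpotent_lie_algebra (lie_algebra A) \<and> stratification (lie_algebra A) V l"

definition homogeneous_dim :: "(nat \<Rightarrow> 'g vfield set) \<Rightarrow> nat \<Rightarrow> nat" where
  "homogeneous_dim V l = (\<Sum>j=1..l. j * dim (V j))"

definition basis_of :: "(nat \<Rightarrow> 'g vfield) \<Rightarrow> nat \<Rightarrow> 'g vfield set \<Rightarrow> bool" where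
  "basis_of X N W \<longleftrightarrow>
     inj_on X {1..N} \<and> independent (X ` {1..N}) \<and> span (X ` {1..N}) = W"


section \<open>Exponential map and Haar measure\<close>

text \<open>
  A tangent vector is identified with the derivation it induces; thus \<open>\<gamma>'(s) = v\<close> means that
  \<open>(f \<circ> \<gamma>)'(s) = v f\<close> for every smooth \<open>f\<close>.
\<close>

definition has_velocity ::
  "('g::topological_space, 'e::euclidean_space) atlas \<Rightarrow> (real \<Rightarrow> 'g) \<Rightarrow> (('g \<Rightarrow> real) \<Rightarrow> real) \<Rightarrow> real \<Rightarrow> bool" where
  "has_velocity A \<gamma> v s \<longleftrightarrow>
     (\<forall>f. smooth_fun A f \<longrightarrow> ((\<lambda>u. f (\<gamma> u)) has_real_derivative v f) (at s))"

definition lie_exp ::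
  "('g::{topological_space, zero}, 'e::euclidean_space) atlas \<Rightarrow> 'g vfield \<Rightarrow> 'g" where
  "lie_exp A X =
     (THE y. \<exists>\<gamma>. \<gamma> 0 = 0 \<and> (\<forall>s. has_velocity A \<gamma> (\<lambda>f. X f (\<gamma> s)) s) \<and> \<gamma> 1 = y)"

text \<open>
  Lebesgue measure on the Lie algebra is determined only up to a positive factor; the linear
  isomorphism \<open>\<Lambda>\<close> is the choice of linear coordinates that fixes it.
\<close>

definition haar_measure ::
  "('g::{topological_space, plus, zero}, 'e::euclidean_space) atlas \<Rightarrow> 'g measure \<Rightarrow> bool" where
  "haar_measure A m \<longleftrightarrow>
     (\<exists>\<Lambda> :: 'e \<Rightarrow> 'g vfield. linear \<Lambda> \<and> bij_betw \<Lambda> UNIV (lie_algebra A) \<and>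
        m = distr lborel borel (\<lambda>v. lie_exp A (\<Lambda> v)))"


section \<open>Carnot-Caratheodory distance\<close>

definition abs_continuous_on_interval :: "real \<Rightarrow> real \<Rightarrow> (real \<Rightarrow> real) \<Rightarrow> bool" where
  "abs_continuous_on_interval a b g \<longleftrightarrow>
     (\<forall>\<epsilon>>0. \<exists>\<delta>>0. \<forall>n u v.
        (\<forall>i<n. a \<le> u i \<and> u i \<le> v i \<and> v i \<le> b) \<longrightarrow>
        disjoint_family_on (\<lambda>i. {u i<..<v i}) {..<n::nat} \<longrightarrow>
        (\<Sum>i<n. v i - u i) < \<delta> \<longrightarrow>
        (\<Sum>i<n. \<bar>g (v i) - g (u i)\<bar>) < \<epsilon>)"

text \<open>
  A curve in the group is absolutely continuous if its composition with every smooth function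
  is. By means of cut-off functions, this is the same as absolute continuity in charts.
\<close>

definition abs_continuous_curve ::
  "('g::topological_space, 'e::euclidean_space) atlas \<Rightarrow> real \<Rightarrow> (real \<Rightarrow> 'g) \<Rightarrow> bool" where
  "abs_continuous_curve A T \<gamma> \<longleftrightarrow>
     (\<forall>f. smooth_fun A f \<longrightarrow> abs_continuous_on_interval 0 T (\<lambda>s. f (\<gamma> s)))"

definition subunit_curve ::
  "('g::topological_space, 'e::euclidean_space) atlas \<Rightarrow> (nat \<Rightarrow> 'g vfield) \<Rightarrow> nat \<Rightarrow> real
    \<Rightarrow> (real \<Rightarrow> 'g) \<Rightarrow> bool" where
  "subunit_curve A X N T \<gamma> \<longleftrightarrow>
     abs_continuous_curve A T \<gamma> \<and>
     (\<exists>a :: nat \<Rightarrow> real \<Rightarrow> real. AE s in lborel. s \<in> {0<..<T} \<longrightarrow>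
        has_velocity A \<gamma> (\<lambda>f. \<Sum>j=1..N. a j s * X j f (\<gamma> s)) s \<and>
        (\<Sum>j=1..N. (a j s)\<^sup>2) \<le> 1)"

text \<open>
  On a stratified group, with \<open>X\<close> a basis of the first layer, the set below is nonempty
  (Chow-Rashevskii), so the infimum is a proper one.
\<close>

definition cc_dist ::
  "('g::topological_space, 'e::euclidean_space) atlas \<Rightarrow> (nat \<Rightarrow> 'g vfield) \<Rightarrow> nat \<Rightarrow> 'g \<Rightarrow> 'g \<Rightarrow> real" where
  "cc_dist A X N x y =
     (if x = y then 0
      else Inf {T. T > 0 \<and> (\<exists>\<gamma>. subunit_curve A X N T \<gamma> \<and> \<gamma> 0 = x \<and> \<gamma> T = y)})"

definition cc_ball ::
  "('g::topological_space, 'e::euclidean_space) atlas \<Rightarrow> (nat \<Rightarrow> 'g vfield) \<Rightarrow> nat \<Rightarrow> 'g \<Rightarrow> real \<Rightarrow> 'g set" where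
  "cc_ball A X N x r = {y. cc_dist A X N x y < r}"


section \<open>Heat kernel\<close>

definition sub_laplacian :: "(nat \<Rightarrow> 'g vfield) \<Rightarrow> nat \<Rightarrow> 'g vfield" where
  "sub_laplacian X N f = (\<lambda>x. \<Sum>j=1..N. X j (X j f) x)"

definition test_function ::
  "('g::topological_space, 'e::euclidean_space) atlas \<Rightarrow> ('g \<Rightarrow> real \<Rightarrow> real) \<Rightarrow> bool" where
  "test_function A \<phi> \<longleftrightarrow>
     smooth_fun_time A UNIV \<phi> \<and>
     (\<exists>K. compact K \<and> (\<forall>x t. (x, t) \<notin> K \<longrightarrow> \<phi> x t = 0))"

text \<open>
  \<open>F x t \<xi>\<close>, for \<open>t > 0\<close> and extended by zero to \<open>t \<le> 0\<close>, satisfies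
  \<open>(\<partial>\<^sub>t - \<L>) F(\<cdot>, \<cdot>; \<xi>) = \<delta>\<^sub>(\<^sub>\<xi>\<^sub>,\<^sub>0\<^sub>)\<close> in the sense of distributions. The formal adjoint of
  \<open>\<partial>\<^sub>t - \<L>\<close> with respect to \<open>dm dt\<close> is \<open>- \<partial>\<^sub>t - \<L>\<close>.
\<close>

definition heat_fundamental_solution ::
  "('g::topological_space, 'e::euclidean_space) atlas \<Rightarrow> (nat \<Rightarrow> 'g vfield) \<Rightarrow> nat \<Rightarrow> 'g measure
    \<Rightarrow> ('g \<Rightarrow> real \<Rightarrow> 'g \<Rightarrow> real) \<Rightarrow> bool" where
  "heat_fundamental_solution A X N m F \<longleftrightarrow>
     (\<forall>\<xi> \<phi>. test_function A \<phi> \<longrightarrow>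
        (LINT t:{0<..}|lborel. (LINT x|m.
           F x t \<xi> * (- deriv (\<phi> x) t - sub_laplacian X N (\<lambda>y. \<phi> y t) x))) = \<phi> \<xi> 0)"

definition heat_kernel ::
  "('g::{topological_group_add, t2_space, second_countable_topology}, 'e::euclidean_space) atlas
    \<Rightarrow> (nat \<Rightarrow> 'g vfield) \<Rightarrow> nat \<Rightarrow> 'g measure \<Rightarrow> ('g \<Rightarrow> real \<Rightarrow> real) \<Rightarrow> bool" where
  "heat_kernel A X N m \<Gamma> \<longleftrightarrow>
     smooth_fun_time A {0<..} \<Gamma> \<and>
     (\<forall>x. \<forall>t>0. \<Gamma> x t > 0) \<and>
     heat_fundamental_solution A X N m (\<lambda>x t \<xi>. \<Gamma> (- \<xi> + x) t) \<and>
     (\<forall>x. \<forall>t>0. (LINT \<xi>|m. \<Gamma> (- \<xi> + x) t) = 1)"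

definition radon_measure :: "'g::topological_space measure \<Rightarrow> bool" where
  "radon_measure \<mu> \<longleftrightarrow> sets \<mu> = sets borel \<and> (\<forall>K. compact K \<longrightarrow> emeasure \<mu> K < \<infinity>)"

definition heat_potential ::
  "('g::group_add \<Rightarrow> real \<Rightarrow> real) \<Rightarrow> 'g measure \<Rightarrow> 'g \<Rightarrow> real \<Rightarrow> ennreal" where
  "heat_potential \<Gamma> \<mu> x t = (\<integral>\<^sup>+ \<xi>. ennreal (\<Gamma> (- \<xi> + x) t) \<partial>\<mu>)"

end

theory Submission
  imports Defs "HOL-Real_Asymp.Real_Asymp"
begin

text \<open>
  By left invariance and the Gaussian upper bound, the heat potential at \<open>x\<close> is at most
  \<open>c1 t powr (- Q / 2)\<close> times the integral of \<open>exp (- d(x, \<xi>)\<^sup>2 / (c1 t))\<close>. Writing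
  \<open>exp (- v)\<close> as the integral of \<open>exp (- u)\<close> over \<open>u > v\<close> turns this into an integral of
  measures of balls \<open>B(x, sqrt (c1 t u))\<close>, which the limsup on the right controls for small radii and
  which yields the factor \<open>Gamma ((Q - \<alpha>) / 2 + 1)\<close>. The part of \<open>\<mu>\<close> away from \<open>x\<close> is negligible
  because the Gaussian lower bound and finiteness of the potential at time 1 make a Gaussian in
  \<open>d(x, \<xi>)\<close> integrable.
  Measurability of the balls comes from continuity of \<open>d\<close>, which is read off from the
  Gaussian bounds and the continuity of the kernel.
\<close>

section \<open>Chain rule and left translations\<close>

text \<open>Openness of \<open>S\<close> is what lets an equality on \<open>S\<close> pass to
  Frechet derivatives, which see a full neighbourhood of the point.\<close>

lemma Ck_on_cong:
  assumes "open S" "Ck_on k f S" "\<And>p. p \<in> S \<Longrightarrow> g p = f p"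
  shows "Ck_on k g S"
  using assms(2,3)
proof (induction k arbitrary: f g)
  case 0
  then show ?case by (simp cong: continuous_on_cong)
next
  case (Suc k)
  have der: "(g has_derivative D) (at p)" if "p \<in> S" "(f has_derivative D) (at p)" for p D
    using has_derivative_transform_within_open[OF that(2) assms(1) that(1)] Suc.prems(2) by force
  have f: "(f has_derivative frechet_derivative f (at p)) (at p)" if "p \<in> S" for p
    using Suc.prems(1) that by (auto simp flip: frechet_derivative_works)
  have "g differentiable at p" if "p \<in> S" for p
    using der[OF that f[OF that]] unfolding differentiable_def by blast
  moreover have "Ck_on k (\<lambda>p. frechet_derivative g (at p) b) S" if "b \<in> Basis" for b
    by (rule Suc.IH[of "\<lambda>p. frechet_derivative f (at p) b"])
       (use Suc.prems(1) that in \<open>auto simp flip: frechet_derivative_at[OF der[OF _ f]]\<close>)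
  ultimately show ?case by simp
qed

lemma Ck_on_const: "Ck_on k (\<lambda>p. c) S"
  by (induction k arbitrary: c) auto

text \<open>Allows smoothness to be checked in suitable charts around each point. Derivatives are
  local, so the neighbourhoods for \<open>f\<close> also serve its partial derivatives.\<close>

lemma Ck_on_local:
  assumes "\<And>p. p \<in> S \<Longrightarrow> \<exists>T. open T \<and> p \<in> T \<and> Ck_on k f T"
  shows "Ck_on k f S"
  using assms
proof (induction k arbitrary: f)
  case 0
  then show ?case
    unfolding Ck_on.simps
    by (intro continuous_at_imp_continuous_on ballI) (blast dest: continuous_on_eq_continuous_at)
next
  case (Suc k)
  have "f differentiable at p" if "p \<in> S" for p
    using Suc.prems[OF that] by auto
  moreover have "Ck_on k (\<lambda>p. frechet_derivative f (at p) b) S" if "b \<in> Basis" for b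
  proof (rule Suc.IH)
    fix p assume "p \<in> S"
    from Suc.prems[OF this] that
    show "\<exists>T. open T \<and> p \<in> T \<and> Ck_on k (\<lambda>p. frechet_derivative f (at p) b) T" by auto
  qed
  ultimately show ?case by simp
qed

lemma Ck_on_SucD: "Ck_on (Suc k) f S \<Longrightarrow> Ck_on k f S"
proof (induction k arbitrary: f)
  case 0
  then show ?case
    by (simp add: continuous_at_imp_continuous_on differentiable_imp_continuous_within)
next
  case (Suc k)
  have "Ck_on k (\<lambda>p. frechet_derivative f (at p) b) S" if "b \<in> Basis" for b
    using Suc.prems that by (intro Suc.IH) simp
  then show ?case using Suc.prems by simp
qed

text \<open>Together with \<open>Ck_on_SucE\<close>, this replaces the chosen
  \<open>frechet_derivative\<close> by any family of derivatives, so that inductions on the order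
  can use the usual differentiation rules.\<close>

lemma Ck_on_SucI:
  assumes "open S" "\<And>p. p \<in> S \<Longrightarrow> (f has_derivative f' p) (at p)"
    and "\<And>b. b \<in> Basis \<Longrightarrow> Ck_on k (\<lambda>p. f' p b) S"
  shows "Ck_on (Suc k) f S"
proof -
  have "f differentiable at p" if "p \<in> S" for p
    using assms(2)[OF that] unfolding differentiable_def by blast
  moreover have "Ck_on k (\<lambda>p. frechet_derivative f (at p) b) S" if "b \<in> Basis" for b
    by (rule Ck_on_cong[OF assms(1) assms(3)[OF that]])
       (simp flip: frechet_derivative_at[OF assms(2)])
  ultimately show ?thesis by simp
qed

lemma Ck_on_SucE:
  assumes "Ck_on (Suc k) f S"
  obtains f' where "\<And>p. p \<in> S \<Longrightarrow> (f has_derivative f' p) (at p)"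
    and "\<And>b. b \<in> Basis \<Longrightarrow> Ck_on k (\<lambda>p. f' p b) S"
proof (rule that)
  show "(f has_derivative frechet_derivative f (at p)) (at p)" if "p \<in> S" for p
    using assms that by (simp flip: frechet_derivative_works)
  show "Ck_on k (\<lambda>p. frechet_derivative f (at p) b) S" if "b \<in> Basis" for b
    using assms that by simp
qed

lemma Ck_on_add:
  assumes "open S"
  shows "Ck_on k f S \<Longrightarrow> Ck_on k g S \<Longrightarrow> Ck_on k (\<lambda>p. f p + g p) S"
proof (induction k arbitrary: f g)
  case 0
  then show ?case by (simp add: continuous_on_add)
next
  case (Suc k)
  from Suc.prems(1) obtain f' where f': "\<And>p. p \<in> S \<Longrightarrow> (f has_derivative f' p) (at p)"
    "\<And>b. b \<in> Basis \<Longrightarrow> Ck_on k (\<lambda>p. f' p b) S" by (rule Ck_on_SucE) blast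
  from Suc.prems(2) obtain g' where g': "\<And>p. p \<in> S \<Longrightarrow> (g has_derivative g' p) (at p)"
    "\<And>b. b \<in> Basis \<Longrightarrow> Ck_on k (\<lambda>p. g' p b) S" by (rule Ck_on_SucE) blast
  show ?case
    by (rule Ck_on_SucI[OF assms has_derivative_add[OF f'(1) g'(1)] Suc.IH[OF f'(2) g'(2)]])
qed

lemma Ck_on_sum:
  assumes "open S" "\<And>i. i \<in> I \<Longrightarrow> Ck_on k (f i) S"
  shows "Ck_on k (\<lambda>p. \<Sum>i\<in>I. f i p) S"
  using assms(2)
  by (induction I rule: infinite_finite_induct) (simp_all add: Ck_on_const Ck_on_add[OF assms(1)])

lemma Ck_on_bounded_linear:
  assumes "open S" "bounded_linear h"
  shows "Ck_on k f S \<Longrightarrow> Ck_on k (\<lambda>p. h (f p)) S"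
proof (induction k arbitrary: f)
  case 0
  then show ?case using bounded_linear.continuous_on[OF assms(2)] by simp
next
  case (Suc k)
  from Suc.prems obtain f' where f': "\<And>p. p \<in> S \<Longrightarrow> (f has_derivative f' p) (at p)"
    "\<And>b. b \<in> Basis \<Longrightarrow> Ck_on k (\<lambda>p. f' p b) S" by (rule Ck_on_SucE) blast
  show ?case
    by (rule Ck_on_SucI[OF assms(1) bounded_linear.has_derivative[OF assms(2) f'(1)] Suc.IH[OF f'(2)]])
qed

lemma Ck_on_scaleR:
  assumes "open S"
  shows "Ck_on k f S \<Longrightarrow> Ck_on k g S \<Longrightarrow> Ck_on k (\<lambda>p. f p *\<^sub>R g p) S"
proof (induction k arbitrary: f g)
  case 0
  then show ?case by (simp add: continuous_on_scaleR)
next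
  case (Suc k)
  from Suc.prems(1) obtain f' where f': "\<And>p. p \<in> S \<Longrightarrow> (f has_derivative f' p) (at p)"
    "\<And>b. b \<in> Basis \<Longrightarrow> Ck_on k (\<lambda>p. f' p b) S" by (rule Ck_on_SucE) blast
  from Suc.prems(2) obtain g' where g': "\<And>p. p \<in> S \<Longrightarrow> (g has_derivative g' p) (at p)"
    "\<And>b. b \<in> Basis \<Longrightarrow> Ck_on k (\<lambda>p. g' p b) S" by (rule Ck_on_SucE) blast
  \<comment> \<open>The product rule pairs each factor with a derivative of the other, so the
    undifferentiated factor is first lowered from order \<open>Suc k\<close> to
    \<open>k\<close>.\<close>
  show ?case
    by (rule Ck_on_SucI[OF assms has_derivative_scaleR[OF f'(1) g'(1)]
          Ck_on_add[OF assms Suc.IH[OF Ck_on_SucD[OF Suc.prems(1)] g'(2)]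
            Suc.IH[OF f'(2) Ck_on_SucD[OF Suc.prems(2)]]]])
qed

text \<open>The chain rule, expanded along \<open>Basis\<close>, writes the derivative of the
  composite as a finite sum of products of coordinates of \<open>g'\<close> with partial derivatives
  of \<open>f\<close> evaluated at \<open>g p\<close>. The induction hypothesis is applied to these
  partial derivatives, hence the arbitrary \<open>f\<close>.\<close>

lemma Ck_on_compose:
  fixes f :: "'b::euclidean_space \<Rightarrow> 'c::real_normed_vector" and g :: "'a::euclidean_space \<Rightarrow> 'b"
  assumes "open S"
  shows "Ck_on k f T \<Longrightarrow> Ck_on k g S \<Longrightarrow> g ` S \<subseteq> T \<Longrightarrow> Ck_on k (\<lambda>p. f (g p)) S"
proof (induction k arbitrary: f g)
  case 0
  then show ?case by (auto intro: continuous_on_compose2)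
next
  case (Suc k)
  from Suc.prems(1) obtain f' where f': "\<And>p. p \<in> T \<Longrightarrow> (f has_derivative f' p) (at p)"
    "\<And>b. b \<in> Basis \<Longrightarrow> Ck_on k (\<lambda>p. f' p b) T" by (rule Ck_on_SucE) blast
  from Suc.prems(2) obtain g' where g': "\<And>p. p \<in> S \<Longrightarrow> (g has_derivative g' p) (at p)"
    "\<And>b. b \<in> Basis \<Longrightarrow> Ck_on k (\<lambda>p. g' p b) S" by (rule Ck_on_SucE) blast
  have inT: "g p \<in> T" if "p \<in> S" for p
    using Suc.prems(3) that by blast
  have "((\<lambda>p. f (g p)) has_derivative (\<lambda>b. \<Sum>i\<in>Basis. (g' p b \<bullet> i) *\<^sub>R f' (g p) i)) (at p)"
    if "p \<in> S" for p
  proof -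
    have lin: "linear (f' (g p))"
      by (rule has_derivative_linear[OF f'(1)[OF inT[OF that]]])
    have "f' (g p) (g' p b) = (\<Sum>i\<in>Basis. (g' p b \<bullet> i) *\<^sub>R f' (g p) i)" for b
      by (subst euclidean_representation[of "g' p b", symmetric])
         (simp only: linear_sum[OF lin] linear_cmul[OF lin])
    then show ?thesis
      using has_derivative_compose[OF g'(1)[OF that] f'(1)[OF inT[OF that]]] by simp
  qed
  moreover have "Ck_on k (\<lambda>p. \<Sum>i\<in>Basis. (g' p b \<bullet> i) *\<^sub>R f' (g p) i) S" if "b \<in> Basis" for b
    by (intro Ck_on_sum[OF assms] Ck_on_scaleR[OF assms]
        Ck_on_bounded_linear[OF assms bounded_linear_inner_left] g'(2)[OF that]
        Suc.IH[OF f'(2) Ck_on_SucD[OF Suc.prems(2)] Suc.prems(3)])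
  ultimately show ?case
    by (rule Ck_on_SucI[OF assms])
qed

lemma Ck_on_Pair:
  assumes "open S"
  shows "Ck_on k (\<lambda>q. (c, q)) S"
proof (cases k)
  case 0
  then show ?thesis by (simp add: continuous_on_Pair)
next
  case (Suc j)
  have "((\<lambda>q. (c, q)) has_derivative (\<lambda>b. (0, b))) (at p)" for p
    by (auto intro!: derivative_eq_intros)
  then show ?thesis
    unfolding Suc by (rule Ck_on_SucI[OF assms _ Ck_on_const])
qed

text \<open>The group law is given as a smooth map of pairs in charts. Freezing its first argument
  at the coordinates of \<open>a\<close> makes the translation smooth in charts, and composing with
  \<open>f\<close> read in a chart around \<open>a + x\<close> gives the claim.\<close>

lemma smooth_fun_left_translation:
  fixes A :: "('g::{topological_group_add, t2_space, second_countable_topology}, 'e::euclidean_space) atlas"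
  assumes "lie_group A" "smooth_fun A f"
  shows "smooth_fun A (\<lambda>x. f (a + x))"
  unfolding smooth_fun_def smooth_on_def
proof safe
  fix U :: "'g set" and \<phi> :: "'g \<Rightarrow> 'e" and k
  assume U: "(U, \<phi>) \<in> A"
  have chart: "open V" "open (\<psi> ` V)" "homeomorphism V (\<psi> ` V) \<psi> (inv_into V \<psi>)"
    if "(V, \<psi>) \<in> A" for V and \<psi> :: "'g \<Rightarrow> 'e"
    using assms(1) that unfolding lie_group_def smooth_atlas_def by auto
  have cover: "\<exists>V \<psi>. (V, \<psi>) \<in> A \<and> x \<in> V" for x
  proof -
    have "(\<Union>(V, \<psi>)\<in>A. V) = UNIV"
      using assms(1) unfolding lie_group_def smooth_atlas_def by blast
    then have "x \<in> (\<Union>(V, \<psi>)\<in>A. V)" by simp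
    then show ?thesis by auto
  qed
  show "Ck_on k (\<lambda>p. f (a + inv_into U \<phi> p)) (\<phi> ` U)"
  proof (rule Ck_on_local)
    fix p assume "p \<in> \<phi> ` U"
    then obtain x where x: "x \<in> U" "p = \<phi> x" by auto
    obtain V \<psi> where V: "(V, \<psi>) \<in> A" "a \<in> V" using cover by blast
    obtain W \<omega> where W: "(W, \<omega>) \<in> A" "a + x \<in> W" using cover by blast
    \<comment> \<open>The part of the chart image whose translates stay in \<open>W\<close>; only
      there does \<open>inv_into W \<omega>\<close> undo \<open>\<omega>\<close>.\<close>
    let ?T = "\<phi> ` U \<inter> (\<lambda>q. a + inv_into U \<phi> q) -` W"
    have "continuous_on (\<phi> ` U) (\<lambda>q. a + inv_into U \<phi> q)"
      using chart(3)[OF U] by (auto simp: homeomorphism_def intro: continuous_intros)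
    then have T: "open ?T"
      using continuous_open_preimage chart[OF U] chart[OF W(1)] by blast
    have inv: "inv_into V' \<psi>' (\<psi>' y) = y" if "(V', \<psi>') \<in> A" "y \<in> V'" for V' \<psi>' y
      using chart(3)[OF that(1)] that(2) by (auto simp: homeomorphism_def)
    let ?D = "{(\<psi> y, \<phi> z) |y z. y \<in> V \<and> z \<in> U \<and> y + z \<in> W}"
    have M: "Ck_on k (\<lambda>(p, q). \<omega> (inv_into V \<psi> p + inv_into U \<phi> q)) ?D"
    proof -
      have "\<forall>(V, \<psi>)\<in>A. \<forall>(U, \<phi>)\<in>A. \<forall>(W, \<omega>)\<in>A.
        smooth_on (\<lambda>(p, q). \<omega> (inv_into V \<psi> p + inv_into U \<phi> q))
          {(\<psi> y, \<phi> z) |y z. y \<in> V \<and> z \<in> U \<and> y + z \<in> W}"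
        using assms(1) unfolding lie_group_def by (elim conjE)
      from this[rule_format, OF V(1), simplified, rule_format, OF U, simplified, rule_format, OF W(1)]
      show ?thesis by (simp add: smooth_on_def)
    qed
    have "Ck_on k (\<lambda>q. (\<lambda>(p, q). \<omega> (inv_into V \<psi> p + inv_into U \<phi> q)) (\<psi> a, q)) ?T"
      by (rule Ck_on_compose[OF T M Ck_on_Pair[OF T]]) (use inv[OF U] V(2) in fastforce)
    then have M': "Ck_on k (\<lambda>q. \<omega> (a + inv_into U \<phi> q)) ?T"
      using inv[OF V] by simp
    have "Ck_on k (\<lambda>p. f (inv_into W \<omega> p)) (\<omega> ` W)"
      using assms(2) W unfolding smooth_fun_def smooth_on_def by auto
    from Ck_on_compose[OF T this M']
    have "Ck_on k (\<lambda>q. f (inv_into W \<omega> (\<omega> (a + inv_into U \<phi> q)))) ?T"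
      by auto
    then have "Ck_on k (\<lambda>q. f (a + inv_into U \<phi> q)) ?T"
      by (rule Ck_on_cong[OF T]) (use inv[OF W(1)] in auto)
    moreover have "p \<in> ?T"
      using x W inv[OF U] by auto
    ultimately show "\<exists>T. open T \<and> p \<in> T \<and> Ck_on k (\<lambda>p. f (a + inv_into U \<phi> p)) T"
      using T by blast
  qed
qed


section \<open>The Carnot-Caratheodory distance\<close>

lemma abs_continuous_on_interval_cong:
  assumes "\<And>s. a \<le> s \<Longrightarrow> s \<le> b \<Longrightarrow> f s = g s"
  shows "abs_continuous_on_interval a b f \<longleftrightarrow> abs_continuous_on_interval a b g"
proof -
  have "(\<Sum>i<n. \<bar>f (v i) - f (u i)\<bar>) = (\<Sum>i<n. \<bar>g (v i) - g (u i)\<bar>)"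
    if "\<forall>i<n. a \<le> u i \<and> u i \<le> v i \<and> v i \<le> b" for n :: nat and u v
  proof (rule sum.cong[OF refl])
    fix i assume "i \<in> {..<n}"
    then have "a \<le> u i" "u i \<le> v i" "v i \<le> b" using that by auto
    then show "\<bar>f (v i) - f (u i)\<bar> = \<bar>g (v i) - g (u i)\<bar>"
      using assms[of "u i"] assms[of "v i"] by simp
  qed
  then show ?thesis
    unfolding abs_continuous_on_interval_def by (simp cong: imp_cong)
qed

lemma abs_continuous_on_interval_shift:
  assumes "abs_continuous_on_interval a b f"
  shows "abs_continuous_on_interval (a + c) (b + c) (\<lambda>s. f (s - c))"
  unfolding abs_continuous_on_interval_def
proof (intro allI impI)
  fix \<epsilon> :: real assume "\<epsilon> > 0"
  then obtain \<delta> where \<delta>: "\<delta> > 0" and *: "\<And>n u v. (\<forall>i<n. a \<le> u i \<and> u i \<le> v i \<and> v i \<le> b) \<Longrightarrow>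
      disjoint_family_on (\<lambda>i. {u i<..<v i}) {..<n::nat} \<Longrightarrow> (\<Sum>i<n. v i - u i) < \<delta> \<Longrightarrow>
      (\<Sum>i<n. \<bar>f (v i) - f (u i)\<bar>) < \<epsilon>"
    using assms unfolding abs_continuous_on_interval_def by meson
  show "\<exists>\<delta>>0. \<forall>n u v. (\<forall>i<n. a + c \<le> u i \<and> u i \<le> v i \<and> v i \<le> b + c) \<longrightarrow>
      disjoint_family_on (\<lambda>i. {u i<..<v i}) {..<n::nat} \<longrightarrow> (\<Sum>i<n. v i - u i) < \<delta> \<longrightarrow>
      (\<Sum>i<n. \<bar>f (v i - c) - f (u i - c)\<bar>) < \<epsilon>"
  proof (intro exI[of _ \<delta>] conjI \<delta> allI impI)
    fix n :: nat and u v :: "nat \<Rightarrow> real"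
    assume 1: "\<forall>i<n. a + c \<le> u i \<and> u i \<le> v i \<and> v i \<le> b + c"
      and 2: "disjoint_family_on (\<lambda>i. {u i<..<v i}) {..<n}" and 3: "(\<Sum>i<n. v i - u i) < \<delta>"
    have "{u i - c<..<v i - c} = (\<lambda>s. s + c) -` {u i<..<v i}" for i
      by auto
    then have "disjoint_family_on (\<lambda>i. {u i - c<..<v i - c}) {..<n}"
      using 2 unfolding disjoint_family_on_def by (metis vimage_Int vimage_empty)
    then show "(\<Sum>i<n. \<bar>f (v i - c) - f (u i - c)\<bar>) < \<epsilon>"
      by (intro *) (use 1 3 in auto)
  qed
qed

lemma abs_continuous_on_interval_reflect:
  assumes "abs_continuous_on_interval a b f"
  shows "abs_continuous_on_interval (c - b) (c - a) (\<lambda>s. f (c - s))"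
  unfolding abs_continuous_on_interval_def
proof (intro allI impI)
  fix \<epsilon> :: real assume "\<epsilon> > 0"
  then obtain \<delta> where \<delta>: "\<delta> > 0" and *: "\<And>n u v. (\<forall>i<n. a \<le> u i \<and> u i \<le> v i \<and> v i \<le> b) \<Longrightarrow>
      disjoint_family_on (\<lambda>i. {u i<..<v i}) {..<n::nat} \<Longrightarrow> (\<Sum>i<n. v i - u i) < \<delta> \<Longrightarrow>
      (\<Sum>i<n. \<bar>f (v i) - f (u i)\<bar>) < \<epsilon>"
    using assms unfolding abs_continuous_on_interval_def by meson
  show "\<exists>\<delta>>0. \<forall>n u v. (\<forall>i<n. c - b \<le> u i \<and> u i \<le> v i \<and> v i \<le> c - a) \<longrightarrow>
      disjoint_family_on (\<lambda>i. {u i<..<v i}) {..<n::nat} \<longrightarrow> (\<Sum>i<n. v i - u i) < \<delta> \<longrightarrow>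
      (\<Sum>i<n. \<bar>f (c - v i) - f (c - u i)\<bar>) < \<epsilon>"
  proof (intro exI[of _ \<delta>] conjI \<delta> allI impI)
    fix n :: nat and u v :: "nat \<Rightarrow> real"
    assume 1: "\<forall>i<n. c - b \<le> u i \<and> u i \<le> v i \<and> v i \<le> c - a"
      and 2: "disjoint_family_on (\<lambda>i. {u i<..<v i}) {..<n}" and 3: "(\<Sum>i<n. v i - u i) < \<delta>"
    have "{c - v i<..<c - u i} = (\<lambda>s. c - s) -` {u i<..<v i}" for i
      by auto
    then have "disjoint_family_on (\<lambda>i. {c - v i<..<c - u i}) {..<n}"
      using 2 unfolding disjoint_family_on_def by (metis vimage_Int vimage_empty)
    then have "(\<Sum>i<n. \<bar>f (c - u i) - f (c - v i)\<bar>) < \<epsilon>"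
      by (intro *) (use 1 3 in \<open>auto simp: algebra_simps\<close>)
    then show "(\<Sum>i<n. \<bar>f (c - v i) - f (c - u i)\<bar>) < \<epsilon>"
      by (simp add: abs_minus_commute)
  qed
qed

text \<open>Every interval is cut at \<open>b\<close> by truncating its endpoints with
  \<open>min\<close> and \<open>max\<close>. Both truncated families remain disjoint with no greater
  total length, and an interval straddling \<open>b\<close> is treated by the triangle
  inequality.\<close>

lemma abs_continuous_on_interval_join:
  assumes "abs_continuous_on_interval a b f" "abs_continuous_on_interval b c f" "a \<le> b" "b \<le> c"
  shows "abs_continuous_on_interval a c f"
  unfolding abs_continuous_on_interval_def
proof (intro allI impI)
  fix \<epsilon> :: real assume "\<epsilon> > 0"
  then have \<epsilon>: "\<epsilon> / 2 > 0" by simp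
  obtain \<delta>1 where \<delta>1: "\<delta>1 > 0" and *: "\<And>n u v. (\<forall>i<n. a \<le> u i \<and> u i \<le> v i \<and> v i \<le> b) \<Longrightarrow>
      disjoint_family_on (\<lambda>i. {u i<..<v i}) {..<n::nat} \<Longrightarrow> (\<Sum>i<n. v i - u i) < \<delta>1 \<Longrightarrow>
      (\<Sum>i<n. \<bar>f (v i) - f (u i)\<bar>) < \<epsilon> / 2"
    using assms(1) \<epsilon> unfolding abs_continuous_on_interval_def by meson
  obtain \<delta>2 where \<delta>2: "\<delta>2 > 0" and **: "\<And>n u v. (\<forall>i<n. b \<le> u i \<and> u i \<le> v i \<and> v i \<le> c) \<Longrightarrow>
      disjoint_family_on (\<lambda>i. {u i<..<v i}) {..<n::nat} \<Longrightarrow> (\<Sum>i<n. v i - u i) < \<delta>2 \<Longrightarrow>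
      (\<Sum>i<n. \<bar>f (v i) - f (u i)\<bar>) < \<epsilon> / 2"
    using assms(2) \<epsilon> unfolding abs_continuous_on_interval_def by meson
  show "\<exists>\<delta>>0. \<forall>n u v. (\<forall>i<n. a \<le> u i \<and> u i \<le> v i \<and> v i \<le> c) \<longrightarrow>
      disjoint_family_on (\<lambda>i. {u i<..<v i}) {..<n::nat} \<longrightarrow> (\<Sum>i<n. v i - u i) < \<delta> \<longrightarrow>
      (\<Sum>i<n. \<bar>f (v i) - f (u i)\<bar>) < \<epsilon>"
  proof (intro exI[of _ "min \<delta>1 \<delta>2"] conjI allI impI)
    fix n :: nat and u v :: "nat \<Rightarrow> real"
    assume 1: "\<forall>i<n. a \<le> u i \<and> u i \<le> v i \<and> v i \<le> c"
      and 2: "disjoint_family_on (\<lambda>i. {u i<..<v i}) {..<n}" and 3: "(\<Sum>i<n. v i - u i) < min \<delta>1 \<delta>2"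
    have sub: "{min (u i) b<..<min (v i) b} \<subseteq> {u i<..<v i}" "{max (u i) b<..<max (v i) b} \<subseteq> {u i<..<v i}"
      for i by auto
    have "disjoint_family_on (\<lambda>i. {min (u i) b<..<min (v i) b}) {..<n}"
      using 2 sub unfolding disjoint_family_on_def by blast
    moreover have "(\<Sum>i<n. min (v i) b - min (u i) b) \<le> (\<Sum>i<n. v i - u i)"
      using 1 by (intro sum_mono) auto
    ultimately have A: "(\<Sum>i<n. \<bar>f (min (v i) b) - f (min (u i) b)\<bar>) < \<epsilon> / 2"
      by (intro *) (use 1 3 assms(3) in auto)
    have "disjoint_family_on (\<lambda>i. {max (u i) b<..<max (v i) b}) {..<n}"
      using 2 sub unfolding disjoint_family_on_def by blast
    moreover have "(\<Sum>i<n. max (v i) b - max (u i) b) \<le> (\<Sum>i<n. v i - u i)"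
      using 1 by (intro sum_mono) auto
    ultimately have B: "(\<Sum>i<n. \<bar>f (max (v i) b) - f (max (u i) b)\<bar>) < \<epsilon> / 2"
      by (intro **) (use 1 3 assms(4) in auto)
    have "\<bar>f (v i) - f (u i)\<bar> \<le> \<bar>f (min (v i) b) - f (min (u i) b)\<bar> + \<bar>f (max (v i) b) - f (max (u i) b)\<bar>"
      if "i < n" for i
      using 1[rule_format, OF that] by (cases "v i \<le> b"; cases "u i \<le> b") auto
    then have "(\<Sum>i<n. \<bar>f (v i) - f (u i)\<bar>) \<le>
        (\<Sum>i<n. \<bar>f (min (v i) b) - f (min (u i) b)\<bar> + \<bar>f (max (v i) b) - f (max (u i) b)\<bar>)"
      by (intro sum_mono) auto
    also have "\<dots> < \<epsilon>"
      using A B by (simp add: sum.distrib)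
    finally show "(\<Sum>i<n. \<bar>f (v i) - f (u i)\<bar>) < \<epsilon>" .
  qed (use \<delta>1 \<delta>2 in auto)
qed

text \<open>The set where \<open>P\<close> fails need not be measurable, so it is enclosed in a
  Borel null set before the affine change of variables is applied.\<close>

lemma AE_lborel_affine:
  fixes c t :: real
  assumes "AE s in lborel. P s" "c \<noteq> 0"
  shows "AE s in lborel. P (t + c * s)"
proof -
  obtain Z where Z: "{s. \<not> P s} \<subseteq> Z" "Z \<in> null_sets lborel"
    using assms(1) by (auto simp: eventually_ae_filter)
  then have "AE s in lborel. s \<notin> Z" by (simp add: AE_not_in)
  moreover have "Measurable.pred borel (\<lambda>s. s \<notin> Z)"
    using Z(2) by (auto simp: null_sets_def)
  ultimately have "AE s in lborel. t + c * s \<notin> Z"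
    using AE_borel_affine[OF assms(2)] by blast
  then show ?thesis
    by eventually_elim (use Z(1) in blast)
qed

section \<open>Translation, reversal and concatenation of subunit curves\<close>

definition subunit_path ::
  "('g::topological_space, 'e::euclidean_space) atlas \<Rightarrow> (nat \<Rightarrow> 'g vfield) \<Rightarrow> nat \<Rightarrow> real \<Rightarrow> 'g \<Rightarrow> 'g \<Rightarrow> bool"
  where "subunit_path A X N T x y \<longleftrightarrow>
    T > 0 \<and> (\<exists>\<gamma>. subunit_curve A X N T \<gamma> \<and> \<gamma> 0 = x \<and> \<gamma> T = y)"

lemma cc_dist_eq: "cc_dist A X N x y = (if x = y then 0 else Inf {T. subunit_path A X N T x y})"
  unfolding cc_dist_def subunit_path_def ..

text \<open>The same controls \<open>c\<close> serve the translated curve, because left invariance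
  moves the translation from the test function to the base point.\<close>

lemma subunit_path_translation:
  fixes A :: "('g::{topological_group_add, t2_space, second_countable_topology}, 'e::euclidean_space) atlas"
  assumes "lie_group A" "\<forall>j\<in>{1..N}. left_invariant A (X j)" "subunit_path A X N T x y"
  shows "subunit_path A X N T (a + x) (a + y)"
proof -
  obtain \<gamma> c where T: "T > 0" and \<gamma>: "abs_continuous_curve A T \<gamma>" "\<gamma> 0 = x" "\<gamma> T = y"
    and vel: "AE s in lborel. s \<in> {0<..<T} \<longrightarrow>
        has_velocity A \<gamma> (\<lambda>f. \<Sum>j=1..N. c j s * X j f (\<gamma> s)) s \<and> (\<Sum>j=1..N. (c j s)\<^sup>2) \<le> 1"
    using assms(3) unfolding subunit_path_def subunit_curve_def by blast
  note smooth = smooth_fun_left_translation[OF assms(1)]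
  have "abs_continuous_curve A T (\<lambda>s. a + \<gamma> s)"
    using \<gamma>(1) smooth unfolding abs_continuous_curve_def by blast
  moreover have "has_velocity A (\<lambda>s. a + \<gamma> s) (\<lambda>f. \<Sum>j=1..N. c j s * X j f (a + \<gamma> s)) s"
    if "has_velocity A \<gamma> (\<lambda>f. \<Sum>j=1..N. c j s * X j f (\<gamma> s)) s" for s
    unfolding has_velocity_def
  proof (intro allI impI)
    fix f assume f: "smooth_fun A f"
    have "X j (\<lambda>x. f (a + x)) (\<gamma> s) = X j f (a + \<gamma> s)" if "j \<in> {1..N}" for j
      using assms(2) that f unfolding left_invariant_def by simp
    then show "((\<lambda>u. f (a + \<gamma> u)) has_real_derivative (\<Sum>j=1..N. c j s * X j f (a + \<gamma> s))) (at s)"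
      using that smooth[OF f, of a] unfolding has_velocity_def by (auto cong: sum.cong_simp)
  qed
  then have "AE s in lborel. s \<in> {0<..<T} \<longrightarrow>
        has_velocity A (\<lambda>s. a + \<gamma> s) (\<lambda>f. \<Sum>j=1..N. c j s * X j f (a + \<gamma> s)) s \<and>
        (\<Sum>j=1..N. (c j s)\<^sup>2) \<le> 1"
    using vel by auto
  ultimately have "subunit_curve A X N T (\<lambda>s. a + \<gamma> s)"
    unfolding subunit_curve_def by blast
  then show ?thesis
    using T \<gamma> unfolding subunit_path_def by auto
qed

lemma subunit_path_reverse:
  assumes "subunit_path A X N T x y"
  shows "subunit_path A X N T y x"
proof -
  obtain \<gamma> c where T: "T > 0" and \<gamma>: "abs_continuous_curve A T \<gamma>" "\<gamma> 0 = x" "\<gamma> T = y"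
    and vel: "AE s in lborel. s \<in> {0<..<T} \<longrightarrow>
        has_velocity A \<gamma> (\<lambda>f. \<Sum>j=1..N. c j s * X j f (\<gamma> s)) s \<and> (\<Sum>j=1..N. (c j s)\<^sup>2) \<le> 1"
    using assms unfolding subunit_path_def subunit_curve_def by blast
  define \<gamma>' where "\<gamma>' = (\<lambda>s. \<gamma> (T - s))"
  \<comment> \<open>Reversing time flips the sign of the velocity and hence of the controls; their
    squares are unaffected.\<close>
  define c' where "c' = (\<lambda>j s. - c j (T - s))"
  have "abs_continuous_curve A T \<gamma>'"
    unfolding abs_continuous_curve_def \<gamma>'_def
  proof (intro allI impI)
    fix f assume "smooth_fun A f"
    then have "abs_continuous_on_interval 0 T (\<lambda>s. f (\<gamma> s))"
      using \<gamma>(1) unfolding abs_continuous_curve_def by blast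
    from abs_continuous_on_interval_reflect[OF this, of T]
    show "abs_continuous_on_interval 0 T (\<lambda>s. f (\<gamma> (T - s)))" by simp
  qed
  moreover have "has_velocity A \<gamma>' (\<lambda>f. \<Sum>j=1..N. c' j s * X j f (\<gamma>' s)) s"
    if "has_velocity A \<gamma> (\<lambda>f. \<Sum>j=1..N. c j (T - s) * X j f (\<gamma> (T - s))) (T - s)" for s
    unfolding has_velocity_def
  proof (intro allI impI)
    fix f assume "smooth_fun A f"
    then have "((\<lambda>u. f (\<gamma> u)) has_real_derivative (\<Sum>j=1..N. c j (T - s) * X j f (\<gamma> (T - s)))) (at (T - s))"
      using that unfolding has_velocity_def by blast
    moreover have "((\<lambda>s. T - s) has_real_derivative -1) (at s)"
      by (auto intro!: derivative_eq_intros)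
    ultimately have "((\<lambda>u. f (\<gamma> (T - u))) has_real_derivative
        (\<Sum>j=1..N. c j (T - s) * X j f (\<gamma> (T - s))) * -1) (at s)"
      by (rule DERIV_chain2[where f = "\<lambda>u. f (\<gamma> u)" and g = "\<lambda>s. T - s"])
    then show "((\<lambda>u. f (\<gamma>' u)) has_real_derivative (\<Sum>j=1..N. c' j s * X j f (\<gamma>' s))) (at s)"
      unfolding \<gamma>'_def c'_def by (simp add: sum_negf)
  qed
  moreover have "AE s in lborel. T + (-1) * s \<in> {0<..<T} \<longrightarrow>
        has_velocity A \<gamma> (\<lambda>f. \<Sum>j=1..N. c j (T + (-1) * s) * X j f (\<gamma> (T + (-1) * s))) (T + (-1) * s) \<and>
        (\<Sum>j=1..N. (c j (T + (-1) * s))\<^sup>2) \<le> 1"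
    by (rule AE_lborel_affine[OF vel]) simp
  then have "AE s in lborel. s \<in> {0<..<T} \<longrightarrow>
        has_velocity A \<gamma> (\<lambda>f. \<Sum>j=1..N. c j (T - s) * X j f (\<gamma> (T - s))) (T - s) \<and>
        (\<Sum>j=1..N. (c j (T - s))\<^sup>2) \<le> 1"
    by eventually_elim auto
  ultimately have "AE s in lborel. s \<in> {0<..<T} \<longrightarrow>
        has_velocity A \<gamma>' (\<lambda>f. \<Sum>j=1..N. c' j s * X j f (\<gamma>' s)) s \<and> (\<Sum>j=1..N. (c' j s)\<^sup>2) \<le> 1"
    by (auto simp: c'_def)
  then have "subunit_curve A X N T \<gamma>'"
    using \<open>abs_continuous_curve A T \<gamma>'\<close> unfolding subunit_curve_def by blast
  then show ?thesis
    using T \<gamma> unfolding subunit_path_def \<gamma>'_def by force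
qed

lemma subunit_path_join:
  assumes "subunit_path A X N S x y" "subunit_path A X N T y z"
  shows "subunit_path A X N (S + T) x z"
proof -
  obtain \<gamma>1 c1 where S: "S > 0" and \<gamma>1: "abs_continuous_curve A S \<gamma>1" "\<gamma>1 0 = x" "\<gamma>1 S = y"
    and vel1: "AE s in lborel. s \<in> {0<..<S} \<longrightarrow>
        has_velocity A \<gamma>1 (\<lambda>f. \<Sum>j=1..N. c1 j s * X j f (\<gamma>1 s)) s \<and> (\<Sum>j=1..N. (c1 j s)\<^sup>2) \<le> 1"
    using assms(1) unfolding subunit_path_def subunit_curve_def by blast
  obtain \<gamma>2 c2 where T: "T > 0" and \<gamma>2: "abs_continuous_curve A T \<gamma>2" "\<gamma>2 0 = y" "\<gamma>2 T = z"
    and vel2: "AE s in lborel. s \<in> {0<..<T} \<longrightarrow>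
        has_velocity A \<gamma>2 (\<lambda>f. \<Sum>j=1..N. c2 j s * X j f (\<gamma>2 s)) s \<and> (\<Sum>j=1..N. (c2 j s)\<^sup>2) \<le> 1"
    using assms(2) unfolding subunit_path_def subunit_curve_def by blast
  define \<gamma> where "\<gamma> = (\<lambda>s. if s \<le> S then \<gamma>1 s else \<gamma>2 (s - S))"
  define c where "c = (\<lambda>j s. if s \<le> S then c1 j s else c2 j (s - S))"
  have "abs_continuous_curve A (S + T) \<gamma>"
    unfolding abs_continuous_curve_def
  proof (intro allI impI)
    fix f assume f: "smooth_fun A f"
    have "abs_continuous_on_interval 0 S (\<lambda>s. f (\<gamma>1 s))"
      using \<gamma>1(1) f unfolding abs_continuous_curve_def by blast
    then have 1: "abs_continuous_on_interval 0 S (\<lambda>s. f (\<gamma> s))"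
      by (subst abs_continuous_on_interval_cong[of _ _ _ "\<lambda>s. f (\<gamma>1 s)"]) (auto simp: \<gamma>_def)
    have "abs_continuous_on_interval (0 + S) (T + S) (\<lambda>s. f (\<gamma>2 (s - S)))"
      using \<gamma>2(1) f abs_continuous_on_interval_shift[of 0 T "\<lambda>s. f (\<gamma>2 s)" S]
      unfolding abs_continuous_curve_def by blast
    then have 2: "abs_continuous_on_interval S (S + T) (\<lambda>s. f (\<gamma> s))"
      using \<gamma>1 \<gamma>2
      by (subst abs_continuous_on_interval_cong[of _ _ _ "\<lambda>s. f (\<gamma>2 (s - S))"])
         (auto simp: \<gamma>_def add.commute)
    show "abs_continuous_on_interval 0 (S + T) (\<lambda>s. f (\<gamma> s))"
      using S T by (intro abs_continuous_on_interval_join[OF 1 2]) auto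
  qed
  moreover have "AE s in lborel. s \<in> {0<..<S + T} \<longrightarrow>
        has_velocity A \<gamma> (\<lambda>f. \<Sum>j=1..N. c j s * X j f (\<gamma> s)) s \<and> (\<Sum>j=1..N. (c j s)\<^sup>2) \<le> 1"
  proof -
    have "AE s in lborel. - S + 1 * s \<in> {0<..<T} \<longrightarrow>
        has_velocity A \<gamma>2 (\<lambda>f. \<Sum>j=1..N. c2 j (- S + 1 * s) * X j f (\<gamma>2 (- S + 1 * s))) (- S + 1 * s) \<and>
        (\<Sum>j=1..N. (c2 j (- S + 1 * s))\<^sup>2) \<le> 1"
      by (rule AE_lborel_affine[OF vel2]) simp
    \<comment> \<open>At the junction time the glued curve may have a corner; a single instant is
      negligible.\<close>
    moreover have "AE s in lborel. s \<noteq> S"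
      by (rule AE_lborel_singleton)
    ultimately show ?thesis
      using vel1
    proof eventually_elim
      fix s
      assume v2: "- S + 1 * s \<in> {0<..<T} \<longrightarrow>
        has_velocity A \<gamma>2 (\<lambda>f. \<Sum>j=1..N. c2 j (- S + 1 * s) * X j f (\<gamma>2 (- S + 1 * s))) (- S + 1 * s) \<and>
        (\<Sum>j=1..N. (c2 j (- S + 1 * s))\<^sup>2) \<le> 1"
        and "s \<noteq> S"
        and v1: "s \<in> {0<..<S} \<longrightarrow>
        has_velocity A \<gamma>1 (\<lambda>f. \<Sum>j=1..N. c1 j s * X j f (\<gamma>1 s)) s \<and> (\<Sum>j=1..N. (c1 j s)\<^sup>2) \<le> 1"
      show "s \<in> {0<..<S + T} \<longrightarrow>
        has_velocity A \<gamma> (\<lambda>f. \<Sum>j=1..N. c j s * X j f (\<gamma> s)) s \<and> (\<Sum>j=1..N. (c j s)\<^sup>2) \<le> 1"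
      proof (cases "s < S")
        case True
        have "has_velocity A \<gamma> v s" if "has_velocity A \<gamma>1 v s" for v
          unfolding has_velocity_def
        proof (intro allI impI)
          fix f assume "smooth_fun A f"
          then have "((\<lambda>u. f (\<gamma>1 u)) has_real_derivative v f) (at s)"
            using that unfolding has_velocity_def by blast
          then show "((\<lambda>u. f (\<gamma> u)) has_real_derivative v f) (at s)"
            by (rule has_field_derivative_transform_within_open[where S = "{..<S}"])
               (use True in \<open>auto simp: \<gamma>_def\<close>)
        qed
        then show ?thesis
          using v1 True by (auto simp: \<gamma>_def c_def)
      next
        case False
        then have sS: "S < s" using \<open>s \<noteq> S\<close> by simp
        have "has_velocity A \<gamma> v s" if v: "has_velocity A \<gamma>2 v (s - S)" for v
          unfolding has_velocity_def
        proof (intro allI impI)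
          fix f assume "smooth_fun A f"
          then have "((\<lambda>u. f (\<gamma>2 u)) has_real_derivative v f) (at (s - S))"
            using v unfolding has_velocity_def by blast
          then have "((\<lambda>u. f (\<gamma>2 (u - S))) has_real_derivative v f) (at s)"
            using DERIV_shift[of "\<lambda>u. f (\<gamma>2 u)" "v f" s "- S"] by simp
          then show "((\<lambda>u. f (\<gamma> u)) has_real_derivative v f) (at s)"
            by (rule has_field_derivative_transform_within_open[where S = "{S<..}"])
               (use sS in \<open>auto simp: \<gamma>_def\<close>)
        qed
        then show ?thesis
          using v2 sS by (auto simp: \<gamma>_def c_def)
      qed
    qed
  qed
  ultimately have "subunit_curve A X N (S + T) \<gamma>"
    unfolding subunit_curve_def by blast
  moreover have "\<gamma> 0 = x" "\<gamma> (S + T) = z"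
    using S T \<gamma>1 \<gamma>2 by (auto simp: \<gamma>_def)
  ultimately show ?thesis
    using S T unfolding subunit_path_def by auto
qed

section \<open>Invariance and metric properties of the distance\<close>

text \<open>Translation by \<open>- a\<close> undoes translation by \<open>a\<close>, so the two
  sets of admissible times are equal and not merely nested.\<close>

lemma cc_dist_left_translation:
  fixes A :: "('g::{topological_group_add, t2_space, second_countable_topology}, 'e::euclidean_space) atlas"
  assumes "lie_group A" "\<forall>j\<in>{1..N}. left_invariant A (X j)"
  shows "cc_dist A X N (a + x) (a + y) = cc_dist A X N x y"
proof -
  have "subunit_path A X N T (a + x) (a + y) \<longleftrightarrow> subunit_path A X N T x y" for T
    using subunit_path_translation[OF assms, where a = a and x = x and y = y]
      subunit_path_translation[OF assms, where a = "- a" and x = "a + x" and y = "a + y"] by auto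
  then show ?thesis by (simp add: cc_dist_eq)
qed

lemma cc_dist_commute: "cc_dist A X N x y = cc_dist A X N y x"
proof -
  have "subunit_path A X N T x y \<longleftrightarrow> subunit_path A X N T y x" for T
    using subunit_path_reverse by blast
  then show ?thesis by (simp add: cc_dist_eq)
qed

text \<open>Reachability keeps the infimum away from the empty set, where its value on
  \<open>real\<close> is unspecified.\<close>

lemma cc_dist_nonneg:
  assumes "x = y \<or> (\<exists>T. subunit_path A X N T x y)"
  shows "cc_dist A X N x y \<ge> 0"
  using assms unfolding cc_dist_eq
  by (auto intro!: cInf_greatest simp: subunit_path_def)

text \<open>Concatenation adds admissible times. The two infima are then taken one after the other,
  first over \<open>T\<close> with \<open>S\<close> fixed, then over \<open>S\<close>.\<close>

lemma cc_dist_triangle: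
  assumes "x = y \<or> (\<exists>T. subunit_path A X N T x y)" "y = z \<or> (\<exists>T. subunit_path A X N T y z)"
  shows "cc_dist A X N x z \<le> cc_dist A X N x y + cc_dist A X N y z"
proof -
  consider "x = y \<or> y = z" | "x = z" | "x \<noteq> y" "y \<noteq> z" "x \<noteq> z" by blast
  then show ?thesis
  proof cases
    case 1
    then show ?thesis by (auto simp: cc_dist_eq)
  next
    case 2
    then show ?thesis using cc_dist_nonneg[OF assms(1)] cc_dist_nonneg[OF assms(2)]
      by (simp add: cc_dist_eq)
  next
    case 3
    have bdd: "bdd_below {T. subunit_path A X N T u v}" for u v
      by (rule bdd_belowI[of _ 0]) (auto simp: subunit_path_def)
    have "Inf {T. subunit_path A X N T x z} - S \<le> Inf {T. subunit_path A X N T y z}"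
      if S: "subunit_path A X N S x y" for S
    proof (rule cInf_greatest)
      show "{T. subunit_path A X N T y z} \<noteq> {}" using assms 3 by auto
      fix T assume "T \<in> {T. subunit_path A X N T y z}"
      then have "S + T \<in> {T. subunit_path A X N T x z}"
        using subunit_path_join[OF S] by blast
      then have "Inf {T. subunit_path A X N T x z} \<le> S + T"
        by (rule cInf_lower[OF _ bdd])
      then show "Inf {T. subunit_path A X N T x z} - S \<le> T" by simp
    qed
    then have "Inf {T. subunit_path A X N T x z} - Inf {T. subunit_path A X N T y z} \<le>
        Inf {T. subunit_path A X N T x y}"
      using assms 3 by (intro cInf_greatest) (auto simp: algebra_simps)
    then show ?thesis using 3 by (simp add: cc_dist_eq)
  qed
qed

section \<open>Continuity of the distance, deduced from the heat kernel\<close>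

text \<open>On each left translate \<open>?nb x\<close> of \<open>W\<close>, membership in
  \<open>H\<close> agrees with membership of \<open>x\<close>. Hence both \<open>H\<close> and its
  complement are open.\<close>

lemma open_subgroup_eq_UNIV:
  fixes H :: "'g::topological_group_add set"
  assumes conn: "connected (UNIV :: 'g set)"
    and H: "0 \<in> H" "\<And>x y. x \<in> H \<Longrightarrow> y \<in> H \<Longrightarrow> x + y \<in> H" "\<And>x. x \<in> H \<Longrightarrow> - x \<in> H"
    and W: "open W" "0 \<in> W" "W \<subseteq> H"
  shows "H = UNIV"
proof -
  let ?nb = "\<lambda>x. (\<lambda>y. - x + y) -` W"
  have nb: "open (?nb x)" "x \<in> ?nb x" for x
    using W by (auto intro!: open_vimage continuous_intros)
  have *: "y \<in> H \<longleftrightarrow> x \<in> H" if "y \<in> ?nb x" for x y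
  proof -
    have "- x + y \<in> H" using that W by auto
    moreover have "y = x + (- x + y)" "x = y + - (- x + y)" by (simp_all add: minus_add add.assoc[symmetric] del: add_uminus_conv_diff)
    ultimately show ?thesis using H(2)[of x "- x + y"] H(2)[of y "- (- x + y)"] H(3) by auto
  qed
  have "\<exists>T. open T \<and> x \<in> T \<and> T \<subseteq> H" if "x \<in> H" for x
    using nb[of x] *[of _ x] that by (intro exI[of _ "?nb x"]) blast
  then have "open H"
    by (subst open_subopen) blast
  moreover have "\<exists>T. open T \<and> x \<in> T \<and> T \<subseteq> - H" if "x \<in> - H" for x
    using nb[of x] *[of _ x] that by (intro exI[of _ "?nb x"]) blast
  then have "open (- H)"
    by (subst open_subopen) blast
  then have "closed H" by (simp add: closed_def)
  ultimately have "H = {} \<or> H = UNIV"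
    using conn unfolding connected_clopen by simp
  then show ?thesis using H(1) by blast
qed

text \<open>
  The hypothesis \<open>sq\<close> is what the two-sided Gaussian bounds give. It replaces the
  Chow-Rashevskii theorem: if the points reachable from 0 did not form an open subgroup,
  points at the junk distance \<open>Inf {}\<close> would accumulate everywhere, and \<open>sq\<close> would
  force the distance to vanish identically.
\<close>

lemma continuous_on_cc_dist:
  fixes A :: "('g::{topological_group_add, t2_space, second_countable_topology}, 'e::euclidean_space) atlas"
  assumes lie: "lie_group A" and li: "\<forall>j\<in>{1..N}. left_invariant A (X j)"
    and conn: "connected (UNIV :: 'g set)"
    and sq: "\<And>y \<eta>. \<eta> > 0 \<Longrightarrow> eventually (\<lambda>z.
        (cc_dist A X N 0 z)\<^sup>2 \<le> C * (cc_dist A X N 0 y)\<^sup>2 + \<eta> \<and>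
        (cc_dist A X N 0 y)\<^sup>2 \<le> C * (cc_dist A X N 0 z)\<^sup>2 + \<eta>) (nhds y)"
  shows "continuous_on UNIV (cc_dist A X N x)" and "\<And>y. cc_dist A X N x y \<ge> 0"
proof -
  let ?d = "cc_dist A X N"
  note left = cc_dist_left_translation[OF lie li]
  \<comment> \<open>Concatenation, translation and reversal of curves make the set of points
    reachable from the identity a subgroup.\<close>
  define H where "H = {y. y = 0 \<or> (\<exists>T. subunit_path A X N T 0 y)}"
  have reach: "x = y \<or> (\<exists>T. subunit_path A X N T x y)" if H: "- x + y \<in> H" for x y
  proof (cases "x = y")
    case False
    then have "- x + y \<noteq> 0" by (metis add.right_inverse add.assoc add.left_neutral add.right_neutral)
    then obtain T where "subunit_path A X N T 0 (- x + y)"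
      using H unfolding H_def by blast
    from subunit_path_translation[OF lie li this, where a = x] show ?thesis
      by (auto simp: add.assoc[symmetric])
  qed simp
  have H_add: "x + y \<in> H" if "x \<in> H" "y \<in> H" for x y
  proof -
    have "x = x + y \<or> (\<exists>T. subunit_path A X N T x (x + y))"
      by (rule reach) (use that in \<open>simp add: add.assoc[symmetric]\<close>)
    then show ?thesis
      using that subunit_path_join[of A X N _ 0 x _ "x + y"] unfolding H_def by auto
  qed
  have H_minus: "- x \<in> H" if x: "x \<in> H" for x
  proof (cases "x = 0")
    case False
    then obtain T where "subunit_path A X N T 0 x" using x by (auto simp: H_def)
    from subunit_path_reverse[OF subunit_path_translation[OF lie li this, where a = "- x"]]
    show ?thesis by (auto simp: H_def)
  qed (simp add: H_def)
  have "continuous_on UNIV (?d x) \<and> (\<forall>y. ?d x y \<ge> 0)"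
  proof (cases "H = UNIV")
    case True
    have conn: "u = v \<or> (\<exists>T. subunit_path A X N T u v)" for u v
      using reach[of u v] True by simp
    have nonneg: "?d u v \<ge> 0" for u v
      by (rule cc_dist_nonneg[OF conn])
    \<comment> \<open>Reduces continuity at every point to continuity of the distance from the
      identity at 0.\<close>
    have lip: "\<bar>?d x z - ?d x y\<bar> \<le> ?d 0 (- y + z)" for y z
    proof -
      have "?d 0 (- y + z) = ?d y z"
        using left[of y 0 "- y + z"] by (simp add: add.assoc[symmetric])
      moreover have "?d x z \<le> ?d x y + ?d y z" "?d x y \<le> ?d x z + ?d z y"
        by (rule cc_dist_triangle[OF conn conn])+
      ultimately show ?thesis using cc_dist_commute[of A X N y z] by auto
    qed
    have "(?d x \<longlongrightarrow> ?d x y) (nhds y)" for y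
    proof (rule tendstoI)
      fix e :: real assume e: "e > 0"
      have "filterlim (\<lambda>z. - y + z) (nhds (- y + y)) (nhds y)"
        by (intro tendsto_intros filterlim_ident)
      then have "filterlim (\<lambda>z. - y + z) (nhds 0) (nhds y)" by simp
      \<comment> \<open>For \<open>y = 0\<close> the term with \<open>C\<close> in \<open>sq\<close>
        vanishes; the half leaves room for a strict inequality below.\<close>
      moreover have "eventually (\<lambda>z. (?d 0 z)\<^sup>2 \<le> e\<^sup>2 / 2) (nhds 0)"
        using sq[of "e\<^sup>2 / 2" 0] e by (auto simp: cc_dist_eq[of A X N 0 0] elim: eventually_mono)
      ultimately have "eventually (\<lambda>z. (?d 0 (- y + z))\<^sup>2 \<le> e\<^sup>2 / 2) (nhds y)"
        unfolding filterlim_iff by blast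
      then show "eventually (\<lambda>z. dist (?d x z) (?d x y) < e) (nhds y)"
      proof eventually_elim
        case (elim z)
        then have "(?d 0 (- y + z))\<^sup>2 < e\<^sup>2"
          using e by (smt (verit) field_sum_of_halves zero_less_power)
        then have "?d 0 (- y + z) < e"
          using e by (simp add: power2_less_imp_less)
        then show ?case using lip[of z y] by (simp add: dist_real_def)
      qed
    qed
    then have "continuous_on UNIV (?d x)"
      by (simp add: continuous_on_eq_continuous_at isCont_def tendsto_nhds_iff)
    then show ?thesis using nonneg by blast
  next
    case False
    \<comment> \<open>Otherwise a neighbourhood of 0 would lie in \<open>H\<close>, and the open
      subgroup \<open>H\<close> would be the whole connected group.\<close>
    have out: "\<exists>z. z \<notin> H \<and> P z" if "eventually P (nhds 0)" for P
    proof (rule ccontr)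
      assume *: "\<not> ?thesis"
      obtain W where "open W" "0 \<in> W" "\<And>z. z \<in> W \<Longrightarrow> P z"
        using \<open>eventually P (nhds 0)\<close> unfolding eventually_nhds by blast
      moreover from this * have "W \<subseteq> H" by blast
      moreover have "0 \<in> H" by (simp add: H_def)
      ultimately have "H = UNIV"
        using open_subgroup_eq_UNIV[OF conn _ H_add H_minus] by blast
      then show False using False by simp
    qed
    \<comment> \<open>The value that \<open>cc_dist\<close> assigns to pairs without a connecting
      curve. Unreachable points come arbitrarily close to 0, so \<open>sq\<close> at
      \<open>y = 0\<close> forces \<open>K = 0\<close>.\<close>
    define K :: real where "K = Inf {}"
    have d_out: "?d 0 z = K" if "z \<notin> H" for z
    proof -
      have "{T. subunit_path A X N T 0 z} = {}" "z \<noteq> 0" using that by (auto simp: H_def)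
      then show ?thesis by (simp add: cc_dist_eq K_def)
    qed
    have "K\<^sup>2 \<le> 0"
    proof (rule field_le_epsilon)
      fix \<eta> :: real assume "\<eta> > 0"
      from out[OF sq[OF this, of 0]] show "K\<^sup>2 \<le> 0 + \<eta>"
        using d_out by (auto simp: cc_dist_eq[of A X N 0 0])
    qed
    then have K: "K = 0" by simp
    have zero: "?d 0 y = 0" for y
    proof (cases "y \<in> H")
      case y: True
      have "(?d 0 y)\<^sup>2 \<le> 0"
      proof (rule field_le_epsilon)
        fix \<eta> :: real assume \<eta>: "\<eta> > 0"
        \<comment> \<open>Right translates \<open>z + y\<close> with \<open>z\<close> outside
          \<open>H\<close> and near 0 are unreachable points near \<open>y\<close>. Their distance
          is \<open>K = 0\<close>, and \<open>sq\<close> passes this on to \<open>y\<close>.\<close>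
        have "filterlim (\<lambda>z. z + y) (nhds (0 + y)) (nhds 0)"
          by (intro tendsto_intros filterlim_ident)
        then have "filterlim (\<lambda>z. z + y) (nhds y) (nhds 0)" by simp
        then have "eventually (\<lambda>z. (?d 0 y)\<^sup>2 \<le> C * (?d 0 (z + y))\<^sup>2 + \<eta>) (nhds 0)"
          using sq[OF \<eta>, of y] unfolding filterlim_iff by (auto elim: eventually_mono)
        from out[OF this] obtain z where z: "z \<notin> H" "(?d 0 y)\<^sup>2 \<le> C * (?d 0 (z + y))\<^sup>2 + \<eta>" by blast
        have "z + y \<notin> H"
          using H_add[OF _ H_minus[OF y], of "z + y"] z(1) by (auto simp: add.assoc)
        then show "(?d 0 y)\<^sup>2 \<le> 0 + \<eta>" using z d_out K by simp
      qed
      then show ?thesis by simp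
    qed (use d_out K in simp)
    have "?d x y = 0" for y
      using left[of x 0 "- x + y"] zero[of "- x + y"] by (simp add: add.assoc[symmetric])
    then show ?thesis
      by (simp cong: continuous_on_cong)
  qed
  then show "continuous_on UNIV (?d x)" "\<And>y. ?d x y \<ge> 0" by auto
qed

text \<open>Here \<open>q\<close> and \<open>p\<close> stand for the kernel at time \<open>t\<close>
  at two nearby points, lying at distances \<open>a\<close> and \<open>b\<close> from the identity,
  and \<open>exp 1\<close> is slack granted by continuity. Taking logarithms leaves an additive
  error proportional to \<open>t\<close>, which a small \<open>t\<close> makes harmless.\<close>

lemma gaussian_bounds_compare:
  fixes a b c t h :: real
  assumes "c \<ge> 1" "t > 0" "h > 0" "p > 0" "q \<le> exp 1 * p"
    and "inverse c * h * exp (- (c * a\<^sup>2 / t)) \<le> q" "p \<le> c * h * exp (- (b\<^sup>2 / (c * t)))"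
  shows "b\<^sup>2 \<le> c\<^sup>2 * a\<^sup>2 + c * t * (1 + 2 * ln c)"
proof -
  have "inverse c * h * exp (- (c * a\<^sup>2 / t)) \<le> exp 1 * (c * h * exp (- (b\<^sup>2 / (c * t))))"
    using order_trans[OF order_trans[OF assms(6,5)] mult_left_mono[OF assms(7), of "exp 1"]] by simp
  then have "exp (- (c * a\<^sup>2 / t)) \<le> c\<^sup>2 * exp (1 - b\<^sup>2 / (c * t))"
    using assms(1,3) by (simp add: exp_diff exp_minus field_simps power2_eq_square)
  also have "c\<^sup>2 = exp (2 * ln c)"
    using assms(1) by (simp add: exp_double)
  finally have "- (c * a\<^sup>2 / t) \<le> 2 * ln c + (1 - b\<^sup>2 / (c * t))"
    by (simp flip: exp_add)
  then have "b\<^sup>2 / (c * t) \<le> c * a\<^sup>2 / t + (1 + 2 * ln c)" by simp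
  then have "b\<^sup>2 \<le> (c * a\<^sup>2 / t + (1 + 2 * ln c)) * (c * t)"
    using assms(1,2) by (subst (asm) pos_divide_le_eq) auto
  also have "\<dots> = c\<^sup>2 * a\<^sup>2 + c * t * (1 + 2 * ln c)"
    using assms(2) by (simp add: distrib_left distrib_right power2_eq_square)
  finally show ?thesis .
qed

lemma isCont_smooth_fun_time:
  assumes "smooth_atlas A" "smooth_fun_time A I F" "t \<in> I"
  shows "isCont (\<lambda>y. F y t) y"
proof -
  have "y \<in> (\<Union>(U, \<phi>)\<in>A. U)"
    using assms(1) unfolding smooth_atlas_def by simp
  then obtain U \<phi> where U: "(U, \<phi>) \<in> A" "y \<in> U" by auto
  then have chart: "open U" "homeomorphism U (\<phi> ` U) \<phi> (inv_into U \<phi>)"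
    using assms(1) unfolding smooth_atlas_def by auto
  have "Ck_on 0 (\<lambda>(p, t). F (inv_into U \<phi> p) t) (\<phi> ` U \<times> I)"
    using assms(2) U(1) unfolding smooth_fun_time_def smooth_on_def by fastforce
  then have "continuous_on (\<phi> ` U \<times> I) (\<lambda>(p, t). F (inv_into U \<phi> p) t)" by simp
  moreover have "continuous_on U (\<lambda>z. (\<phi> z, t))"
    using chart(2) by (auto simp: homeomorphism_def intro!: continuous_intros)
  ultimately have "continuous_on U (\<lambda>z. (\<lambda>(p, t). F (inv_into U \<phi> p) t) (\<phi> z, t))"
    by (rule continuous_on_compose2) (use assms(3) in auto)
  then have "continuous_on U (\<lambda>z. F z t)"
    using chart(2) by (simp add: homeomorphism_def cong: continuous_on_cong_simp)
  then show ?thesis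
    using chart(1) U(2) continuous_on_eq_continuous_at by blast
qed

text \<open>Supplies the hypothesis \<open>sq\<close> of \<open>continuous_on_cc_dist\<close> with
  \<open>C\<close> equal to the square of \<open>c1\<close>. At a fixed time the kernel is positive
  and continuous, so its values near \<open>y\<close> agree up to a factor \<open>exp 1\<close>, and
  the Gaussian bounds can be compared in both directions.\<close>

lemma heat_kernel_cc_dist_sq:
  assumes atlas: "smooth_atlas A" and ker: "heat_kernel A X N m \<Gamma>" and c1: "c1 \<ge> 1"
    and gauss: "\<forall>y. \<forall>t>0.
           inverse c1 * t powr (- real Q / 2) * exp (- (c1 * (cc_dist A X N 0 y)\<^sup>2 / t)) \<le> \<Gamma> y t \<and>
           \<Gamma> y t \<le> c1 * t powr (- real Q / 2) * exp (- ((cc_dist A X N 0 y)\<^sup>2 / (c1 * t)))"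
    and \<eta>: "\<eta> > 0"
  shows "eventually (\<lambda>z.
        (cc_dist A X N 0 z)\<^sup>2 \<le> c1\<^sup>2 * (cc_dist A X N 0 y)\<^sup>2 + \<eta> \<and>
        (cc_dist A X N 0 y)\<^sup>2 \<le> c1\<^sup>2 * (cc_dist A X N 0 z)\<^sup>2 + \<eta>) (nhds y)"
proof -
  \<comment> \<open>The time at which the error term of \<open>gaussian_bounds_compare\<close> is
    exactly \<open>\<eta>\<close>.\<close>
  define t where "t = \<eta> / (c1 * (1 + 2 * ln c1))"
  have ln: "1 + 2 * ln c1 > 0" using c1 by (simp add: add_pos_nonneg)
  then have t: "t > 0" "c1 * t * (1 + 2 * ln c1) = \<eta>"
    using c1 \<eta> by (auto simp: t_def)
  have pos: "\<Gamma> z t > 0" for z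
    using ker t(1) unfolding heat_kernel_def by blast
  have "smooth_fun_time A {0<..} \<Gamma>"
    using ker unfolding heat_kernel_def by blast
  from isCont_smooth_fun_time[OF atlas this, of t y]
  have lim: "((\<lambda>z. \<Gamma> z t) \<longlongrightarrow> \<Gamma> y t) (nhds y)"
    using t(1) by (simp add: isCont_def tendsto_nhds_iff)
  have "eventually (\<lambda>z. \<Gamma> z t < exp 1 * \<Gamma> y t) (nhds y)"
    by (rule order_tendstoD(2)[OF lim]) (use pos[of y] in simp)
  moreover have "eventually (\<lambda>z. \<Gamma> z t > exp (-1) * \<Gamma> y t) (nhds y)"
    by (rule order_tendstoD(1)[OF lim]) (use pos[of y] in simp)
  ultimately show ?thesis
  proof eventually_elim
    case (elim z)
    have 1: "\<Gamma> z t \<le> exp 1 * \<Gamma> y t" "\<Gamma> y t \<le> exp 1 * \<Gamma> z t"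
      using elim by (simp_all add: exp_minus field_simps)
    note cmp = gaussian_bounds_compare[OF c1 t(1), where h = "t powr (- real Q / 2)", unfolded t(2)]
    have h: "t powr (- real Q / 2) > 0" using t by simp
    show ?case
      using cmp[OF h pos 1(1)] cmp[OF h pos 1(2)] gauss[rule_format, OF t(1)]
      by blast
  qed
qed


section \<open>Gaussian integrals\<close>

text \<open>The open half-line is used so that the level sets of the distance become open balls. It
  differs by one point from the closed one, to which the fundamental theorem of calculus is
  applied.\<close>

lemma nn_integral_exp_tail: "(\<integral>\<^sup>+u. ennreal (exp (- u)) * indicator {v<..} u \<partial>lborel) = ennreal (exp (- v))"
proof -
  have "((\<lambda>u::real. - exp (- u)) \<longlongrightarrow> - 0) at_top"
    by (intro tendsto_minus filterlim_compose[OF exp_at_bot filterlim_uminus_at_bot_at_top])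
  then have "(\<integral>\<^sup>+u. ennreal (exp (- u)) * indicator {v..} u \<partial>lborel) = ennreal (0 - - exp (- v))"
    by (intro nn_integral_FTC_atLeast[where F = "\<lambda>u. - exp (- u)"]) (auto intro!: derivative_eq_intros)
  moreover have "AE u in lborel. u \<noteq> v"
    by (rule AE_lborel_singleton)
  then have "(\<integral>\<^sup>+u. ennreal (exp (- u)) * indicator {v<..} u \<partial>lborel) =
      (\<integral>\<^sup>+u. ennreal (exp (- u)) * indicator {v..} u \<partial>lborel)"
    by (intro nn_integral_cong_AE) (auto simp: indicator_def elim!: eventually_mono)
  ultimately show ?thesis by simp
qed

text \<open>Layer-cake argument: after Tonelli, the inner integral at level \<open>u\<close>
  measures a ball of radius at most \<open>sqrt (t * u)\<close>. Its bound splits into powers of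
  \<open>t\<close> and of \<open>u\<close>, and the latter integrates against
  \<open>exp (- u)\<close> to Euler's integral. The cut-off at \<open>\<delta>\<close> keeps every
  ball within the range of the hypothesis \<open>ball\<close>.\<close>

lemma nn_integral_gaussian_le:
  fixes d :: "'a \<Rightarrow> real" and \<beta> \<delta> C t :: real
  assumes "sigma_finite_measure M" and [measurable]: "d \<in> borel_measurable M"
    and d: "\<And>y. y \<in> space M \<Longrightarrow> d y \<ge> 0" and \<beta>: "\<beta> > 0" and t: "t > 0" and C: "C \<ge> 0" and \<delta>: "\<delta> > 0"
    and ball: "\<And>r. 0 < r \<Longrightarrow> r \<le> \<delta> \<Longrightarrow> emeasure M {y \<in> space M. d y < r} \<le> ennreal (C * r powr \<beta>)"
  shows "(\<integral>\<^sup>+y. ennreal (exp (- ((d y)\<^sup>2 / t))) * indicator {y. d y < \<delta>} y \<partial>M) \<le>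
    ennreal (C * t powr (\<beta> / 2) * Gamma (\<beta> / 2 + 1))"
proof -
  interpret M: sigma_finite_measure M by fact
  interpret pair_sigma_finite M lborel ..
  let ?f = "\<lambda>y u. ennreal (exp (- u)) * indicator {(d y)\<^sup>2 / t<..} u * indicator {y. d y < \<delta>} y"
  have meas: "(\<lambda>(y, u). ?f y u) \<in> borel_measurable (M \<Otimes>\<^sub>M lborel)"
    unfolding indicator_def greaterThan_iff mem_Collect_eq by measurable
  have "(\<integral>\<^sup>+y. ennreal (exp (- ((d y)\<^sup>2 / t))) * indicator {y. d y < \<delta>} y \<partial>M) =
      (\<integral>\<^sup>+y. (\<integral>\<^sup>+u. ?f y u \<partial>lborel) \<partial>M)"
    by (subst nn_integral_multc) (simp_all add: nn_integral_exp_tail)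
  also have "\<dots> = (\<integral>\<^sup>+u. (\<integral>\<^sup>+y. ?f y u \<partial>M) \<partial>lborel)"
    by (rule Fubini'[OF meas, symmetric])
  also have "\<dots> \<le> (\<integral>\<^sup>+u. ennreal (C * t powr (\<beta> / 2)) *
      ennreal (indicator {0..} u * u powr (\<beta> / 2 + 1 - 1) / exp u) \<partial>lborel)"
  proof (rule nn_integral_mono)
    fix u :: real
    show "(\<integral>\<^sup>+y. ?f y u \<partial>M) \<le> ennreal (C * t powr (\<beta> / 2)) *
      ennreal (indicator {0..} u * u powr (\<beta> / 2 + 1 - 1) / exp u)"
    proof (cases "u > 0")
      case True
      \<comment> \<open>The cap is needed to apply \<open>ball\<close>; replacing \<open>r\<close>
        by \<open>sqrt (t * u)\<close> afterwards only increases the bound, since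
        \<open>\<beta> > 0\<close>.\<close>
      define r where "r = min \<delta> (sqrt (t * u))"
      have r: "0 < r" "r \<le> \<delta>" using \<delta> t True by (auto simp: r_def)
      have "d y < r" if "(d y)\<^sup>2 / t < u" "d y < \<delta>" for y
        using that t by (auto simp: r_def field_simps intro: real_less_rsqrt)
      then have "(\<integral>\<^sup>+y. ?f y u \<partial>M) \<le> (\<integral>\<^sup>+y. ennreal (exp (- u)) * indicator {y \<in> space M. d y < r} y \<partial>M)"
        by (intro nn_integral_mono) (auto simp: indicator_def)
      also have "\<dots> = ennreal (exp (- u)) * emeasure M {y \<in> space M. d y < r}"
        by (rule nn_integral_cmult_indicator) measurable
      also have "\<dots> \<le> ennreal (exp (- u)) * ennreal (C * r powr \<beta>)"
        by (intro mult_left_mono ball r) simp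
      also have "\<dots> \<le> ennreal (exp (- u)) * ennreal (C * sqrt (t * u) powr \<beta>)"
        using C r \<beta> by (intro mult_left_mono ennreal_leI powr_mono2) (auto simp: r_def)
      also have "sqrt (t * u) powr \<beta> = t powr (\<beta> / 2) * u powr (\<beta> / 2)"
        using t True by (simp add: powr_half_sqrt[symmetric] powr_powr powr_mult)
      also have "ennreal (exp (- u)) * ennreal (C * (t powr (\<beta> / 2) * u powr (\<beta> / 2))) =
        ennreal (C * t powr (\<beta> / 2)) * ennreal (indicator {0..} u * u powr (\<beta> / 2 + 1 - 1) / exp u)"
        using C True by (simp add: ennreal_mult[symmetric] exp_minus field_simps)
      finally show ?thesis .
    next
      case False
      have "\<not> (d y)\<^sup>2 / t < u" for y
        using False t by (meson divide_nonneg_pos not_less order_trans zero_le_power2)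
      then have "?f y u = 0" for y
        by (simp add: indicator_def)
      then have "(\<integral>\<^sup>+y. ?f y u \<partial>M) = (\<integral>\<^sup>+y. 0 \<partial>M)"
        by (simp only:)
      then show ?thesis by simp
    qed
  qed
  also have "\<dots> = ennreal (C * t powr (\<beta> / 2)) * ennreal (Gamma (\<beta> / 2 + 1))"
    using Gamma_conv_nn_integral_real[of "\<beta> / 2 + 1"] \<beta> by (subst nn_integral_cmult) auto
  also have "\<dots> = ennreal (C * t powr (\<beta> / 2) * Gamma (\<beta> / 2 + 1))"
    using C \<beta> by (simp add: ennreal_mult Gamma_real_pos less_imp_le)
  finally show ?thesis .
qed

text \<open>Half of the exponent gives decay in \<open>t\<close> that is uniform for
  \<open>s \<ge> \<delta>\<close>; for small \<open>t\<close> the other half is bounded by a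
  Gaussian that does not depend on \<open>t\<close>.\<close>

lemma gaussian_tail_le:
  fixes s k t \<delta> :: real
  assumes "s \<ge> \<delta>" "\<delta> > 0" "t > 0" "2 * k * t \<le> 1"
  shows "exp (- (s\<^sup>2 / t)) \<le> exp (- (\<delta>\<^sup>2 / (2 * t))) * exp (- (k * s\<^sup>2))"
proof -
  have "\<delta>\<^sup>2 / (2 * t) \<le> s\<^sup>2 / (2 * t)"
    using assms by (intro divide_right_mono power_mono) auto
  moreover have "k \<le> 1 / (2 * t)"
    using assms by (simp add: field_simps)
  then have "k * s\<^sup>2 \<le> 1 / (2 * t) * s\<^sup>2"
    by (rule mult_right_mono) simp
  moreover have "s\<^sup>2 / t = s\<^sup>2 / (2 * t) + 1 / (2 * t) * s\<^sup>2"
    using assms(3) by (simp add: field_simps)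
  ultimately show ?thesis
    by (simp flip: exp_add)
qed

text \<open>Any \<open>C\<close> above the limsup of the density ratios bounds the balls of radius
  up to some \<open>\<delta>\<close>. The near part then contributes at most \<open>?G * C\<close>,
  the far part vanishes in the limit, and finally \<open>C\<close> descends to the limsup.\<close>

lemma Limsup_gaussian_le:
  fixes d :: "'a \<Rightarrow> real" and \<beta> k :: real
  assumes d[measurable]: "d \<in> borel_measurable M"
    and d_nonneg: "\<And>y. y \<in> space M \<Longrightarrow> d y \<ge> 0" and \<beta>: "\<beta> > 0"
    and k: "k > 0" and fin: "(\<integral>\<^sup>+y. ennreal (exp (- (k * (d y)\<^sup>2))) \<partial>M) < \<infinity>"
  shows "Limsup (at_right 0) (\<lambda>t. ennreal (t powr (- \<beta> / 2)) * (\<integral>\<^sup>+y. ennreal (exp (- ((d y)\<^sup>2 / t))) \<partial>M))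
    \<le> ennreal (Gamma (\<beta> / 2 + 1)) *
      Limsup (at_right 0) (\<lambda>r. emeasure M {y \<in> space M. d y < r} / ennreal (r powr \<beta>))"
    (is "Limsup _ ?F \<le> ennreal ?G * ?L")
proof -
  let ?B = "\<lambda>r. {y \<in> space M. d y < r}"
  define I where "I = enn2real (\<integral>\<^sup>+y. ennreal (exp (- (k * (d y)\<^sup>2))) \<partial>M)"
  have I: "(\<integral>\<^sup>+y. ennreal (exp (- (k * (d y)\<^sup>2))) \<partial>M) = ennreal I"
    using fin by (simp add: I_def)
  have I_nonneg: "I \<ge> 0" by (simp add: I_def)
  have G: "?G > 0" using \<beta> by (intro Gamma_real_pos) auto
  \<comment> \<open>Required for Tonelli. On a ball the Gaussian in \<open>fin\<close> is bounded
    below by a positive constant, so the ball has finite measure; balls of integer radius exhaust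
    the space.\<close>
  have sigma: "sigma_finite_measure M"
  proof
    have "emeasure M (?B (real n)) \<noteq> \<infinity>" for n
    proof -
      have "ennreal (exp (- (k * (real n)\<^sup>2))) * emeasure M (?B (real n)) =
          (\<integral>\<^sup>+y. ennreal (exp (- (k * (real n)\<^sup>2))) * indicator (?B (real n)) y \<partial>M)"
        by (rule nn_integral_cmult_indicator[symmetric]) measurable
      also have "\<dots> \<le> (\<integral>\<^sup>+y. ennreal (exp (- (k * (d y)\<^sup>2))) \<partial>M)"
        using k d_nonneg
        by (intro nn_integral_mono) (auto simp: indicator_def intro!: ennreal_leI power_mono)
      finally have "ennreal (exp (- (k * (real n)\<^sup>2))) * emeasure M (?B (real n)) < \<infinity>"
        using fin by (rule le_less_trans)
      then show ?thesis by (auto simp: ennreal_mult_less_top)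
    qed
    moreover have "(\<Union>n. ?B (real n)) = space M"
      using reals_Archimedean2 by auto
    ultimately show "\<exists>A. countable A \<and> A \<subseteq> sets M \<and> \<Union> A = space M \<and> (\<forall>a\<in>A. emeasure M a \<noteq> \<infinity>)"
      by (intro exI[of _ "range (\<lambda>n. ?B (real n))"]) auto
  qed
  have bound: "Limsup (at_right 0) ?F \<le> ennreal (?G * C)" if C: "?L < ennreal C" "C \<ge> 0" for C
  proof -
    have "eventually (\<lambda>r. emeasure M (?B r) / ennreal (r powr \<beta>) < ennreal C) (at_right 0)"
      by (rule Limsup_lessD[OF C(1)])
    then obtain b where b: "b > 0" "\<And>r. 0 < r \<Longrightarrow> r < b \<Longrightarrow> emeasure M (?B r) / ennreal (r powr \<beta>) < ennreal C"
      unfolding eventually_at_right_field by auto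
    \<comment> \<open>Halving makes the closed range \<open>r \<le> \<delta>\<close> lie strictly
      below \<open>b\<close>.\<close>
    define \<delta> where "\<delta> = b / 2"
    have \<delta>: "\<delta> > 0" using b by (simp add: \<delta>_def)
    have ball: "emeasure M (?B r) \<le> ennreal (C * r powr \<beta>)" if r: "0 < r" "r \<le> \<delta>" for r
    proof -
      have "emeasure M (?B r) = emeasure M (?B r) / ennreal (r powr \<beta>) * ennreal (r powr \<beta>)"
        using r by (simp add: ennreal_divide_times ennreal_mult_divide_eq)
      also have "\<dots> \<le> ennreal C * ennreal (r powr \<beta>)"
        using b r by (intro mult_right_mono) (auto simp: \<delta>_def less_imp_le)
      finally show ?thesis using C by (simp add: ennreal_mult)
    qed
    \<comment> \<open>The normalized weight of the far part: exponential decay beats the negative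
      power of \<open>t\<close>.\<close>
    define h where "h = (\<lambda>t. t powr (- \<beta> / 2) * exp (- (\<delta>\<^sup>2 / (2 * t))))"
    have h: "(h \<longlongrightarrow> 0) (at_right 0)"
      unfolding h_def using \<delta> \<beta> by real_asymp
    have "eventually (\<lambda>t. t < 1 / (2 * k)) (at_right (0::real))"
      by (rule order_tendstoD(2)[OF tendsto_ident_at]) (use k in simp)
    then have "eventually (\<lambda>t. 2 * k * t \<le> 1 \<and> t > 0) (at_right (0::real))"
      using eventually_at_right_less[of 0] by eventually_elim (use k in \<open>auto simp: field_simps\<close>)
    then have "eventually (\<lambda>t. ?F t \<le> ennreal (?G * C + h t * I)) (at_right 0)"
    proof eventually_elim
      case (elim t)
      then have t: "t > 0" "2 * k * t \<le> 1" by auto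
      have "(\<integral>\<^sup>+y. ennreal (exp (- ((d y)\<^sup>2 / t))) \<partial>M) \<le>
          (\<integral>\<^sup>+y. ennreal (exp (- ((d y)\<^sup>2 / t))) * indicator {y. d y < \<delta>} y +
            ennreal (exp (- (\<delta>\<^sup>2 / (2 * t)))) * ennreal (exp (- (k * (d y)\<^sup>2))) \<partial>M)"
        using gaussian_tail_le[OF _ \<delta> t]
        by (intro nn_integral_mono) (auto simp: indicator_def not_less simp flip: ennreal_mult intro!: ennreal_leI)
      also have "\<dots> = (\<integral>\<^sup>+y. ennreal (exp (- ((d y)\<^sup>2 / t))) * indicator {y. d y < \<delta>} y \<partial>M) +
            ennreal (exp (- (\<delta>\<^sup>2 / (2 * t)))) * ennreal I"
        unfolding I[symmetric]
        by (subst nn_integral_add) (simp_all add: nn_integral_cmult)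
      also have "\<dots> \<le> ennreal (C * t powr (\<beta> / 2) * ?G) + ennreal (exp (- (\<delta>\<^sup>2 / (2 * t)))) * ennreal I"
        by (intro add_right_mono nn_integral_gaussian_le sigma d d_nonneg \<beta> t C \<delta> ball)
      also have "\<dots> = ennreal (C * t powr (\<beta> / 2) * ?G + exp (- (\<delta>\<^sup>2 / (2 * t))) * I)"
        using C G I_nonneg by (simp add: ennreal_mult[symmetric] ennreal_plus[symmetric] del: ennreal_plus)
      finally have "?F t \<le> ennreal (t powr (- \<beta> / 2)) *
          ennreal (C * t powr (\<beta> / 2) * ?G + exp (- (\<delta>\<^sup>2 / (2 * t))) * I)"
        by (intro mult_left_mono) auto
      also have "\<dots> = ennreal (t powr (- \<beta> / 2) * (C * t powr (\<beta> / 2) * ?G + exp (- (\<delta>\<^sup>2 / (2 * t))) * I))"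
        by (simp add: ennreal_mult')
      also have "t powr (- \<beta> / 2) * (C * t powr (\<beta> / 2) * ?G + exp (- (\<delta>\<^sup>2 / (2 * t))) * I) =
          (t powr (- \<beta> / 2) * t powr (\<beta> / 2)) * (?G * C) + h t * I"
        by (simp add: h_def algebra_simps)
      also have "t powr (- \<beta> / 2) * t powr (\<beta> / 2) = 1"
        using t by (simp flip: powr_add)
      finally show ?case by simp
    qed
    then have "Limsup (at_right 0) ?F \<le> Limsup (at_right 0) (\<lambda>t. ennreal (?G * C + h t * I))"
      by (rule Limsup_mono)
    also have "\<dots> = ennreal (?G * C + 0 * I)"
      by (intro lim_imp_Limsup tendsto_ennrealI tendsto_intros h) simp
    finally show ?thesis by simp
  qed
  show ?thesis
  proof (cases "?L = \<infinity>")
    case True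
    \<comment> \<open>Positivity of the Gamma factor matters, since zero times infinity is zero in
      \<open>ennreal\<close>.\<close>
    then show ?thesis using G by (simp add: ennreal_mult_top)
  next
    case False
    then obtain l where l: "?L = ennreal l" "l \<ge> 0" by (cases ?L) auto
    show ?thesis
    proof (rule ennreal_le_epsilon)
      fix e :: real assume e: "e > 0"
      then have "?L < ennreal (l + e / ?G)"
        using l G by (simp add: ennreal_lessI)
      from bound[OF this] have "Limsup (at_right 0) ?F \<le> ennreal (?G * (l + e / ?G))"
        using l e G by simp
      also have "?G * (l + e / ?G) = ?G * l + e"
        using G by (simp add: distrib_left)
      also have "ennreal \<dots> = ennreal ?G * ?L + ennreal e"
        using l e G by (simp add: ennreal_mult)
      finally show "Limsup (at_right 0) ?F \<le> ennreal ?G * ?L + ennreal e" .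
    qed
  qed
qed

text \<open>The substitution \<open>u = r\<^sup>2\<close> in Euler's integral for
  \<open>Gamma (\<beta> / 2)\<close>; the factor 2 in \<open>?g\<close> comes from its
  Jacobian.\<close>

lemma LINT_gaussian_powr:
  fixes \<beta> :: real
  assumes "\<beta> > 0"
  shows "(LINT r:{0<..}|lborel. exp (- r\<^sup>2) * r powr (\<beta> - 1)) = Gamma (\<beta> / 2) / 2"
proof -
  let ?f = "\<lambda>u::real. u powr (\<beta> / 2 - 1) / exp u"
  let ?g = "\<lambda>r::real. 2 * (exp (- r\<^sup>2) * r powr (\<beta> - 1))"
  have "u \<in> (\<lambda>r::real. r\<^sup>2) ` {0<..}" if "u > 0" for u
    using that by (intro image_eqI[of _ _ "sqrt u"]) auto
  then have img: "(\<lambda>r::real. r\<^sup>2) ` {0<..} = {0<..}"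
    by auto
  have "(?f has_integral Gamma (\<beta> / 2)) {0..}"
    using Gamma_integral_real[of "\<beta> / 2"] assms by simp
  then have "(?f has_integral Gamma (\<beta> / 2)) {0<..}"
    by (rule has_integral_spike_set_eq[THEN iffD1, rotated -1])
       (auto intro!: negligible_subset[OF negligible_sing[of 0]])
  then have "?f absolutely_integrable_on (\<lambda>r. r\<^sup>2) ` {0<..} \<and> integral ((\<lambda>r. r\<^sup>2) ` {0<..}) ?f = Gamma (\<beta> / 2)"
    unfolding img by (auto simp: has_integral_iff intro!: nonnegative_absolutely_integrable_1)
  then have sub: "(\<lambda>r. \<bar>2 * r\<bar> * ?f (r\<^sup>2)) absolutely_integrable_on {0<..} \<and>
      integral {0<..} (\<lambda>r. \<bar>2 * r\<bar> * ?f (r\<^sup>2)) = Gamma (\<beta> / 2)"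
    by (subst has_absolute_integral_change_of_variables_1')
       (auto intro!: derivative_eq_intros inj_onI)
  have eq: "\<bar>2 * r\<bar> * ?f (r\<^sup>2) = ?g r" if "r \<in> {0<..}" for r
  proof -
    have "(r\<^sup>2) powr (\<beta> / 2 - 1) = r powr (\<beta> - 2)"
      using that by (simp add: powr_powr flip: powr_numeral)
    moreover have "r * r powr (\<beta> - 2) = r powr (\<beta> - 1)"
      using that by (simp add: powr_mult_base)
    ultimately show ?thesis
      using that by (simp add: exp_minus field_simps)
  qed
  have g: "?g absolutely_integrable_on {0<..}"
    by (subst set_integrable_cong[OF refl refl eq[symmetric]]) (use sub in auto)
  have g': "integral {0<..} ?g = Gamma (\<beta> / 2)"
    by (subst integral_cong[OF eq[symmetric]]) (use sub in auto)
  \<comment> \<open>The change of variables is carried out for \<open>lebesgue\<close>, the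
    completion of \<open>lborel\<close>; for a Borel integrand both integrals agree.\<close>
  have "(LINT r:{0<..}|lborel. ?g r) = (LINT r:{0<..}|lebesgue. ?g r)"
    unfolding set_lebesgue_integral_def by (rule integral_completion[symmetric]) measurable
  also have "\<dots> = Gamma (\<beta> / 2)"
    using set_lebesgue_integral_eq_integral(2)[OF g] g' by simp
  finally show ?thesis by simp
qed


section \<open>From heat potentials to Gaussian integrals of the distance\<close>

theorem lemma3p2:
  fixes A :: "('g::{topological_group_add, t2_space, second_countable_topology},
               'e::euclidean_space) atlas"
    and V :: "nat \<Rightarrow> 'g vfield set" and l :: nat
    and X :: "nat \<Rightarrow> 'g vfield" and N :: nat
    and m \<mu> :: "'g measure"
    and \<Gamma> :: "'g \<Rightarrow> real \<Rightarrow> real"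
    and Q :: nat and c1 \<alpha> :: real and x :: 'g
  assumes "stratified_lie_group A V l"
    and "Q = homogeneous_dim V l"
    and "basis_of X N (V 1)"
    and "haar_measure A m"
    and "heat_kernel A X N m \<Gamma>"
    and "c1 \<ge> 1"
    and "\<forall>y. \<forall>t>0.
           inverse c1 * t powr (- real Q / 2) * exp (- (c1 * (cc_dist A X N 0 y)\<^sup>2 / t)) \<le> \<Gamma> y t \<and>
           \<Gamma> y t \<le> c1 * t powr (- real Q / 2) * exp (- ((cc_dist A X N 0 y)\<^sup>2 / (c1 * t)))"
    and "radon_measure \<mu>"
    and "\<forall>y. \<forall>t>0. heat_potential \<Gamma> \<mu> y t < \<infinity>"
    and "0 \<le> \<alpha>" and "\<alpha> < real Q"
  shows "Limsup (at_right 0) (\<lambda>t. ennreal (t powr (\<alpha> / 2)) * heat_potential \<Gamma> \<mu> x t)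
      \<le> ennreal (c1 powr (1 + (real Q - \<alpha>) / 2) * (real Q - \<alpha>) *
                 (LINT r:{0<..}|lborel. exp (- r\<^sup>2) * r powr (real Q - \<alpha> - 1)))
        * Limsup (at_right 0) (\<lambda>r. emeasure \<mu> (cc_ball A X N x r) / ennreal (r powr (real Q - \<alpha>)))"
proof -
  let ?d = "cc_dist A X N"
  define \<beta> where "\<beta> = real Q - \<alpha>"
  have \<beta>: "\<beta> > 0" using assms(11) by (simp add: \<beta>_def)
  have lie: "lie_group A" and conn: "connected (UNIV :: 'g set)"
    and strat: "stratification (lie_algebra A) V l"
    using assms(1) unfolding stratified_lie_group_def by simp_all
  have "1 \<le> l" "\<forall>j\<in>{1..l}. subspace (V j) \<and> V j \<subseteq> lie_algebra A"
    using strat unfolding stratification_def by simp_all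
  then have "V 1 \<subseteq> lie_algebra A" by simp
  moreover have "X ` {1..N} \<subseteq> V 1"
    using assms(3) span_superset[of "X ` {1..N}"] unfolding basis_of_def by simp
  ultimately have li: "\<forall>j\<in>{1..N}. left_invariant A (X j)"
    unfolding lie_algebra_def by blast
  have atlas: "smooth_atlas A"
    using lie unfolding lie_group_def by blast
  note dist = continuous_on_cc_dist[OF lie li conn heat_kernel_cc_dist_sq[OF atlas assms(5-7)]]
  \<comment> \<open>Left translation by \<open>\<xi>\<close> followed by symmetry; this turns the
    argument of the kernel into a distance from \<open>x\<close>.\<close>
  have d_shift: "?d 0 (- \<xi> + x) = ?d x \<xi>" for \<xi>
    using cc_dist_left_translation[OF lie li, of \<xi> 0 "- \<xi> + x"] cc_dist_commute[of A X N \<xi> x]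
    by (simp add: add.assoc[symmetric])
  have sets: "sets \<mu> = sets borel" and space: "space \<mu> = UNIV"
    using assms(8) sets_eq_imp_space_eq[of \<mu> borel] unfolding radon_measure_def by simp_all
  have meas[measurable]: "?d x \<in> borel_measurable \<mu>"
    using borel_measurable_continuous_onI[OF dist(1)] by (simp add: measurable_cong_sets[OF sets refl])
  have fin: "(\<integral>\<^sup>+\<xi>. ennreal (exp (- (c1 * (?d x \<xi>)\<^sup>2))) \<partial>\<mu>) < \<infinity>"
  proof -
    \<comment> \<open>At time 1 the power of \<open>t\<close> in the Gaussian lower bound equals 1,
      which leaves a Gaussian of rate \<open>c1\<close>.\<close>
    have "ennreal (inverse c1) * (\<integral>\<^sup>+\<xi>. ennreal (exp (- (c1 * (?d x \<xi>)\<^sup>2))) \<partial>\<mu>) =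
        (\<integral>\<^sup>+\<xi>. ennreal (inverse c1) * ennreal (exp (- (c1 * (?d x \<xi>)\<^sup>2))) \<partial>\<mu>)"
      by (rule nn_integral_cmult[symmetric]) measurable
    also have "\<dots> \<le> heat_potential \<Gamma> \<mu> x 1"
      unfolding heat_potential_def
    proof (rule nn_integral_mono)
      fix \<xi>
      show "ennreal (inverse c1) * ennreal (exp (- (c1 * (?d x \<xi>)\<^sup>2))) \<le> ennreal (\<Gamma> (- \<xi> + x) 1)"
        using assms(7)[rule_format, of 1 "- \<xi> + x"] assms(6)
        by (auto simp: d_shift ennreal_mult[symmetric] intro!: ennreal_leI)
    qed
    finally have "ennreal (inverse c1) * (\<integral>\<^sup>+\<xi>. ennreal (exp (- (c1 * (?d x \<xi>)\<^sup>2))) \<partial>\<mu>) < \<infinity>"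
      using assms(9) by (metis le_less_trans zero_less_one)
    then show ?thesis
      using assms(6) by (auto simp: ennreal_mult_less_top)
  qed
  let ?F = "\<lambda>t. ennreal (t powr (- \<beta> / 2)) * (\<integral>\<^sup>+\<xi>. ennreal (exp (- ((?d x \<xi>)\<^sup>2 / t))) \<partial>\<mu>)"
  let ?L = "Limsup (at_right 0) (\<lambda>r. emeasure \<mu> (cc_ball A X N x r) / ennreal (r powr (real Q - \<alpha>)))"
  have F: "Limsup (at_right 0) ?F \<le> ennreal (Gamma (\<beta> / 2 + 1)) * ?L"
    using Limsup_gaussian_le[OF meas dist(2) \<beta> _ fin] assms(6) by (simp add: cc_ball_def space \<beta>_def)
  \<comment> \<open>One factor \<open>c1\<close> comes from the Gaussian upper bound and
    \<open>c1 powr (\<beta> / 2)\<close> from evaluating \<open>?F\<close> at the rescaled time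
    \<open>c1 * t\<close>.\<close>
  define K where "K = c1 powr (1 + \<beta> / 2)"
  have pot: "ennreal (t powr (\<alpha> / 2)) * heat_potential \<Gamma> \<mu> x t \<le> ennreal K * ?F (c1 * t)" if t: "t > 0" for t
  proof -
    have "heat_potential \<Gamma> \<mu> x t \<le>
        (\<integral>\<^sup>+\<xi>. ennreal (c1 * t powr (- real Q / 2)) * ennreal (exp (- ((?d x \<xi>)\<^sup>2 / (c1 * t)))) \<partial>\<mu>)"
      unfolding heat_potential_def
    proof (rule nn_integral_mono)
      fix \<xi>
      show "ennreal (\<Gamma> (- \<xi> + x) t) \<le>
          ennreal (c1 * t powr (- real Q / 2)) * ennreal (exp (- ((?d x \<xi>)\<^sup>2 / (c1 * t))))"
        using assms(7)[rule_format, OF t, of "- \<xi> + x"] assms(6)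
        by (auto simp: d_shift ennreal_mult[symmetric] intro!: ennreal_leI)
    qed
    also have "\<dots> = ennreal (c1 * t powr (- real Q / 2)) *
        (\<integral>\<^sup>+\<xi>. ennreal (exp (- ((?d x \<xi>)\<^sup>2 / (c1 * t)))) \<partial>\<mu>)" (is "_ = _ * ?I")
      by (rule nn_integral_cmult) measurable
    finally have "ennreal (t powr (\<alpha> / 2)) * heat_potential \<Gamma> \<mu> x t \<le>
        ennreal (t powr (\<alpha> / 2)) * (ennreal (c1 * t powr (- real Q / 2)) * ?I)"
      by (rule mult_left_mono) simp
    also have "\<dots> = ennreal (t powr (\<alpha> / 2) * (c1 * t powr (- real Q / 2))) * ?I"
      using assms(6) by (simp add: ennreal_mult mult.assoc)
    also have "t powr (\<alpha> / 2) * (c1 * t powr (- real Q / 2)) = K * (c1 * t) powr (- \<beta> / 2)"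
    proof -
      have "t powr (\<alpha> / 2) * (c1 * t powr (- real Q / 2)) = c1 * (t powr (\<alpha> / 2) * t powr (- real Q / 2))"
        by (rule mult.left_commute)
      also have "t powr (\<alpha> / 2) * t powr (- real Q / 2) = t powr (- \<beta> / 2)"
        unfolding powr_add[symmetric] by (simp add: \<beta>_def field_simps)
      also have "c1 * t powr (- \<beta> / 2) = K * c1 powr (- \<beta> / 2) * t powr (- \<beta> / 2)"
        using assms(6) unfolding K_def powr_add[symmetric] by simp
      also have "\<dots> = K * (c1 * t) powr (- \<beta> / 2)"
        using t assms(6) by (simp add: powr_mult)
      finally show ?thesis .
    qed
    also have "ennreal (K * (c1 * t) powr (- \<beta> / 2)) * ?I = ennreal K * ?F (c1 * t)"
      by (simp add: ennreal_mult K_def mult.assoc)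
    finally show ?thesis .
  qed
  \<comment> \<open>Rescaling time by a positive constant preserves the approach to 0 from the
    right, hence the limsup.\<close>
  have "filtermap ((*) c1) (at_right 0) = at_right (0::real)"
    using filtermap_times_pos_at_right[of c1 0] assms(6) by simp
  then have scale: "Limsup (at_right 0) (\<lambda>t. ?F (c1 * t)) = Limsup (at_right 0) ?F"
    using Limsup_filtermap_eq[of "(*) c1" "at_right 0" ?F] assms(6) by (simp add: inj_on_def)
  have "Limsup (at_right 0) (\<lambda>t. ennreal (t powr (\<alpha> / 2)) * heat_potential \<Gamma> \<mu> x t)
      \<le> Limsup (at_right 0) (\<lambda>t. ennreal K * ?F (c1 * t))"
    by (rule Limsup_mono) (rule eventually_mono[OF eventually_at_right_less[of 0] pot])
  \<comment> \<open>Multiplication by a finite constant is continuous and monotone on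
    \<open>ennreal\<close>, so it commutes with the limsup.\<close>
  also have "\<dots> = ennreal K * Limsup (at_right 0) (\<lambda>t. ?F (c1 * t))"
    by (rule Limsup_compose_continuous_mono[where f = "\<lambda>y. ennreal K * y"])
       (auto intro!: ennreal_continuous_on_cmult continuous_on_id monoI mult_left_mono)
  also have "\<dots> \<le> ennreal K * (ennreal (Gamma (\<beta> / 2 + 1)) * ?L)"
    unfolding scale by (rule mult_left_mono[OF F]) simp
  also have "\<dots> = ennreal (K * Gamma (\<beta> / 2 + 1)) * ?L"
    using \<beta> by (simp add: ennreal_mult K_def Gamma_real_pos less_imp_le mult.assoc)
  \<comment> \<open>The recurrence gives \<open>\<beta> / 2 * Gamma (\<beta> / 2)\<close>, and half
    of \<open>Gamma (\<beta> / 2)\<close> is the Gaussian integral.\<close>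
  also have "K * Gamma (\<beta> / 2 + 1) = K * \<beta> * (LINT r:{0<..}|lborel. exp (- r\<^sup>2) * r powr (\<beta> - 1))"
    using \<beta> Gamma_plus1[of "\<beta> / 2"] nonpos_Ints_nonpos[of "\<beta> / 2"]
    by (fastforce simp: LINT_gaussian_powr)
  finally show ?thesis
    by (simp add: K_def \<beta>_def)
qed

end
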